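(* Let $d\geq 4$ be an integer and let $k$ be a field with $\operatorname{char}(k)\nmid 2d$. Let $\mathcal{C}_d\subset\mathbb{P}^2$ be the closure of the affine curve $y^d=\varphi_d(x)$ over $k$, where $\varphi_d$ is the $d$-th Chebyshev polynomial. (i) If $\operatorname{char}(k)=p\geq 3$ and $d=(p^m+1)/2$ for some integer $m\geq 1$, then $\mathcal{C}_d$ has exactly $3d$ total inflection points, namely the points of $\mathcal{C}_d$ lying on the union of the three lines given in the affine coordinates by $y=0$, $x=2$ and $x=-2$. (ii) In all other cases, the total inflection points of $\mathcal{C}_d$ are exactly the $d$ points of $\mathcal{C}_d$ on the line $y=0$.
   Context: The $d$-th Chebyshev polynomial $\varphi_d(X)\in k[X]$ is the unique monic polynomial with $\varphi_d(t+t^{-1})=t^d+t^{-d}$ in $k[t,t^{-1}]$. When $\operatorname{char}(k)\nmid 2d$ it is separable and $\mathcal{C}_d$ is a smooth plane curve of degree $d$. Homogeneously, $\mathcal{C}_d$ is given by $y^d=z^d\varphi_d(x/z)$. Points are taken over an algebraic closure $\overline{k}$ of $k$. A total inflection point of a smooth plane curve $\mathcal{C}\subset\mathbb{P}^2$ of degree $d$ is a point $P\in\mathcal{C}$ such that the tangent line to $\mathcal{C}$ at $P$ meets $\mathcal{C}$ at $P$ with multiplicity $d$. *)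

theory Defs
  imports "HOL-Algebra.Algebraic_Closure_Type" "HOL-Library.Extended_Nat"
begin

section \<open>Chebyshev polynomials\<close>

text \<open>
  The Laurent polynomial ring \<open>k[t, 1/t]\<close> is viewed inside the field of formal Laurent series
  over \<open>k\<close>.
\<close>

definition is_chebyshev :: "nat \<Rightarrow> 'a::field poly \<Rightarrow> bool" where
  "is_chebyshev d p \<longleftrightarrow> lead_coeff p = 1 \<and>
     poly (map_poly fls_const p) (fls_X + fls_X_inv) = fls_X ^ d + fls_X_inv ^ d"

definition chebyshev :: "nat \<Rightarrow> 'a::field poly" where
  "chebyshev d = (THE p. is_chebyshev d p)"

lemma poly_X_plus_X_inv:
  fixes p :: "'a::field poly"
  assumes "p \<noteq> 0"
  shows "poly (map_poly fls_const p) (fls_X + fls_X_inv) \<noteq> 0 \<and>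
         fls_subdegree (poly (map_poly fls_const p) (fls_X + fls_X_inv)) = - int (degree p)"
  using assms
proof (induction p)
  case 0
  then show ?case by simp
next
  case (pCons a p)
  define s where "s = (fls_X + fls_X_inv :: 'a fls)"
  have s: "fls_subdegree s = -1"
    unfolding s_def by (subst fls_subdegree_add_eq2) auto
  then have s0: "s \<noteq> 0" by auto
  have eq: "poly (map_poly fls_const (pCons a p)) s =
      fls_const a + s * poly (map_poly fls_const p) s"
    by (simp add: map_poly_pCons)
  show ?case
  proof (cases "p = 0")
    case True
    then show ?thesis using pCons eq by (simp add: s_def)
  next
    case False
    define q where "q = s * poly (map_poly fls_const p) s"
    have q: "q \<noteq> 0" "fls_subdegree q = - 1 - int (degree p)"
      using pCons.IH[OF False] s s0 by (auto simp: q_def s_def[symmetric])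
    have "fls_subdegree (fls_const a + q) = fls_subdegree q"
      by (rule fls_subdegree_add_eq2) (use q in auto)
    then show ?thesis
      using q False eq by (auto simp: q_def s_def)
  qed
qed

lemma map_poly_fls_const_diff:
  "map_poly fls_const (p - q) = map_poly fls_const p - map_poly fls_const (q :: 'a::field poly)"
  by (intro poly_eqI) (simp add: coeff_map_poly fls_minus_const)

lemma ex_is_chebyshev: "\<exists>p :: 'a::field poly. is_chebyshev (Suc n) p"
proof -
  define s where "s = (fls_X + fls_X_inv :: 'a fls)"
  let ?P = "\<lambda>n (p :: 'a poly). degree p = Suc n \<and> lead_coeff p = 1 \<and>
       poly (map_poly fls_const p) s = fls_X ^ Suc n + fls_X_inv ^ Suc n"
  have XX: "fls_X * fls_X_inv = (1 :: 'a fls)"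
    using fls_inverse_X[where ?'a = 'a] by (metis fls_X_nonzero right_inverse)
  have "(\<exists>p. ?P n p) \<and> (\<exists>p. ?P (Suc n) p)"
  proof (induction n)
    case 0
    have 1: "?P 0 [:0, 1:]" by (simp add: map_poly_pCons s_def)
    have "s * s - fls_const 2 = fls_X ^ 2 + fls_X_inv ^ 2"
      using XX by (simp add: s_def algebra_simps power2_eq_square)
    then have 2: "?P (Suc 0) [:-2, 0, 1:]"
      by (simp add: map_poly_pCons power2_eq_square numeral_2_eq_2)
    from 1 2 show ?case by blast
  next
    case (Suc n)
    then obtain p q where p: "?P n p" and q: "?P (Suc n) q" by blast
    let ?r = "pCons 0 q - p"
    have q0: "q \<noteq> 0" using q by auto
    then have dp: "degree p < degree (pCons 0 q)" using p q by simp
    then have dr: "degree ?r = Suc (Suc (Suc n))"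
      using p q q0 degree_add_eq_left [of "- p" "pCons 0 q"] by auto
    moreover have cq: "poly.coeff q (Suc (Suc n)) = 1" using q by metis
    moreover have "lead_coeff ?r = 1"
      using dr p cq by (simp add: coeff_pCons coeff_eq_0)
    moreover have "poly (map_poly fls_const ?r) s = s * (fls_X ^ Suc (Suc n) + fls_X_inv ^ Suc (Suc n))
         - (fls_X ^ Suc n + fls_X_inv ^ Suc n)"
      using p q by (simp only: map_poly_fls_const_diff) (simp add: map_poly_pCons)
    moreover have "\<dots> = fls_X ^ Suc (Suc (Suc n)) + fls_X_inv ^ Suc (Suc (Suc n))
        + (fls_X * fls_X_inv - 1) * (fls_X ^ Suc n + fls_X_inv ^ Suc n)"
      by (simp add: s_def algebra_simps)
    ultimately have "?P (Suc (Suc n)) ?r" using XX by simp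
    then show ?case using q by blast
  qed
  then show ?thesis unfolding is_chebyshev_def s_def by blast
qed

lemma ex1_is_chebyshev:
  assumes "d > 0"
  shows "\<exists>!p :: 'a::field poly. is_chebyshev d p"
proof (rule ex_ex1I)
  show "\<exists>p :: 'a poly. is_chebyshev d p"
    using ex_is_chebyshev[of "d - 1"] assms by simp
next
  fix p q :: "'a poly"
  assume "is_chebyshev d p" "is_chebyshev d q"
  then have "poly (map_poly fls_const (p - q)) (fls_X + fls_X_inv) = 0"
    by (simp add: is_chebyshev_def map_poly_fls_const_diff)
  then show "p = q" using poly_X_plus_X_inv[of "p - q"] by auto
qed

lemma is_chebyshev_chebyshev: "d > 0 \<Longrightarrow> is_chebyshev d (chebyshev d)"
  unfolding chebyshev_def by (rule theI') (rule ex1_is_chebyshev)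

section \<open>The projective plane\<close>

definition proj_rel :: "'a::field \<times> 'a \<times> 'a \<Rightarrow> 'a \<times> 'a \<times> 'a \<Rightarrow> bool" where
  "proj_rel u v \<longleftrightarrow> u \<noteq> (0, 0, 0) \<and>
     (\<exists>c. c \<noteq> 0 \<and> v = (case u of (x, y, z) \<Rightarrow> (c * x, c * y, c * z)))"

quotient_type (overloaded) 'a proj_plane = "'a::field \<times> 'a \<times> 'a" / partial: proj_rel
proof (rule part_equivpI)
  show "\<exists>x :: 'a \<times> 'a \<times> 'a. proj_rel x x"
    by (rule exI[of _ "(1, 1, 1)"]) (auto simp: proj_rel_def intro: exI[of _ 1])
  show "symp (proj_rel :: 'a \<times> 'a \<times> 'a \<Rightarrow> _)"
  proof (rule sympI)
    fix u v :: "'a \<times> 'a \<times> 'a"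
    assume "proj_rel u v"
    then obtain c where "c \<noteq> 0" "u \<noteq> (0, 0, 0)"
      "v = (case u of (x, y, z) \<Rightarrow> (c * x, c * y, c * z))"
      by (auto simp: proj_rel_def)
    then show "proj_rel v u"
      unfolding proj_rel_def by (cases u) (auto intro!: exI[of _ "inverse c"])
  qed
  show "transp (proj_rel :: 'a \<times> 'a \<times> 'a \<Rightarrow> _)"
  proof (rule transpI)
    fix u v w :: "'a \<times> 'a \<times> 'a"
    assume "proj_rel u v" "proj_rel v w"
    then obtain c c' where "c \<noteq> 0" "c' \<noteq> 0" "u \<noteq> (0, 0, 0)"
      "v = (case u of (x, y, z) \<Rightarrow> (c * x, c * y, c * z))"
      "w = (case v of (x, y, z) \<Rightarrow> (c' * x, c' * y, c' * z))"
      by (auto simp: proj_rel_def)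
    then show "proj_rel u w"
      unfolding proj_rel_def by (cases u) (auto intro!: exI[of _ "c' * c"])
  qed
qed

text \<open>
  An arbitrary choice of homogeneous coordinates; none of the notions below depends on it as long
  as the polynomials are homogeneous.
\<close>

definition coords :: "'a::field proj_plane \<Rightarrow> 'a \<times> 'a \<times> 'a" where
  "coords P = rep_proj_plane P"

definition dot :: "'a::field \<times> 'a \<times> 'a \<Rightarrow> 'a \<times> 'a \<times> 'a \<Rightarrow> 'a" where
  "dot = (\<lambda>(a, b, c) (x, y, z). a * x + b * y + c * z)"

definition proj_line :: "'a::field \<times> 'a \<times> 'a \<Rightarrow> 'a proj_plane set" where
  "proj_line l = {P. dot l (coords P) = 0}"

section \<open>Plane curves and total inflection points\<close>

text \<open>
  \<open>'a poly3\<close> stands for \<open>k[X][Y][Z]\<close>: the outermost variable is \<open>Z\<close>, the innermost one is \<open>X\<close>.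
\<close>

type_synonym 'a poly3 = "'a poly poly poly"

definition const3 :: "'a::comm_semiring_1 \<Rightarrow> 'a poly3" where
  "const3 c = [:[:[:c:]:]:]"

definition var_X :: "'a::comm_semiring_1 poly3" where
  "var_X = [:[:[:0, 1:]:]:]"

definition var_Y :: "'a::comm_semiring_1 poly3" where
  "var_Y = [:[:0, 1:]:]"

definition var_Z :: "'a::comm_semiring_1 poly3" where
  "var_Z = [:0, 1:]"

text \<open>
  Evaluation at a triple over another ring, where \<open>h\<close> is the homomorphism applied to the
  coefficients.
\<close>

definition eval3 ::
    "('a::comm_semiring_1 \<Rightarrow> 'b::comm_semiring_1) \<Rightarrow> 'a poly3 \<Rightarrow> 'b \<times> 'b \<times> 'b \<Rightarrow> 'b" where
  "eval3 h F = (\<lambda>(x, y, z).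
     poly (map_poly (\<lambda>g. poly (map_poly (\<lambda>f. poly (map_poly h f) x) g) y) F) z)"

definition base_change ::
    "('a::comm_semiring_1 \<Rightarrow> 'b::comm_semiring_1) \<Rightarrow> 'a poly3 \<Rightarrow> 'b poly3" where
  "base_change h = map_poly (map_poly (map_poly h))"

definition curve_points :: "'a::field poly3 \<Rightarrow> 'a proj_plane set" where
  "curve_points F = {P. eval3 (\<lambda>c. c) F (coords P) = 0}"

definition gradient :: "'a::field poly3 \<Rightarrow> 'a proj_plane \<Rightarrow> 'a \<times> 'a \<times> 'a" where
  "gradient F P =
    (eval3 (\<lambda>c. c) (map_poly (map_poly pderiv) F) (coords P),
     eval3 (\<lambda>c. c) (map_poly pderiv F) (coords P),
     eval3 (\<lambda>c. c) (pderiv F) (coords P))"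

text \<open>This is a line only when \<open>P\<close> is a nonsingular point, i.e. when the gradient is nonzero.\<close>

definition tangent_line :: "'a::field poly3 \<Rightarrow> 'a proj_plane \<Rightarrow> 'a proj_plane set" where
  "tangent_line F P = proj_line (gradient F P)"

text \<open>The polynomial \<open>F(P + t Q)\<close> in \<open>t\<close>; for \<open>P \<noteq> Q\<close> it is the restriction of \<open>F\<close> to the line
  through \<open>P\<close> and \<open>Q\<close>, with \<open>P\<close> at \<open>t = 0\<close>.\<close>

definition restrict_line :: "'a::field poly3 \<Rightarrow> 'a proj_plane \<Rightarrow> 'a proj_plane \<Rightarrow> 'a poly" where
  "restrict_line F P Q = (case (coords P, coords Q) of ((x, y, z), (x', y', z')) \<Rightarrow>
     eval3 (\<lambda>c. [:c:]) F ([:x, x':], [:y, y':], [:z, z':]))"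

text \<open>
  The intersection multiplicity at \<open>P\<close> of the curve of a form \<open>F\<close> with a line \<open>L\<close> is the order of
  vanishing at \<open>P\<close> of the restriction of \<open>F\<close> to \<open>L\<close>.  The second point \<open>Q\<close> of \<open>L\<close> only serves to
  parametrize \<open>L\<close>: as \<open>F\<close> is homogeneous, another choice does not change the order.
\<close>

definition int_mult :: "'a::field poly3 \<Rightarrow> 'a proj_plane set \<Rightarrow> 'a proj_plane \<Rightarrow> enat" where
  "int_mult F L P =
    (if P \<notin> L then 0
     else let r = restrict_line F P (SOME Q. Q \<in> L \<and> Q \<noteq> P)
          in if r = 0 then \<infinity> else enat (order 0 r))"

definition total_inflection_points :: "nat \<Rightarrow> 'a::field poly3 \<Rightarrow> 'a proj_plane set" where
  "total_inflection_points d F =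
    {P \<in> curve_points F. gradient F P \<noteq> (0, 0, 0) \<and> int_mult F (tangent_line F P) P = enat d}"

section \<open>The curve \<open>y ^ d = z ^ d * \<phi>\<^sub>d (x / z)\<close>\<close>

definition chebyshev_form :: "nat \<Rightarrow> 'a::field poly3" where
  "chebyshev_form d =
     var_Y ^ d - (\<Sum>i\<le>d. const3 (poly.coeff (chebyshev d) i) * var_X ^ i * var_Z ^ (d - i))"

text \<open>The same form, viewed over an algebraic closure.\<close>

definition chebyshev_form_ac :: "'k::field itself \<Rightarrow> nat \<Rightarrow> 'k alg_closure poly3" where
  "chebyshev_form_ac _ d = base_change to_ac (chebyshev_form d :: 'k poly3)"

end

theory Submission
  imports Defs
begin

text \<open>
  Let \<open>\<phi>\<close> be the Chebyshev polynomial of degree \<open>d\<close>.  A total inflection point with \<open>y \<noteq> 0\<close> gives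
  an identity \<open>\<phi> = A (x - b)\<^sup>d + c (x - a)\<^sup>d\<close> or \<open>\<phi> = A (x - b)\<^sup>d + k\<close>.  The differential equation
  \<open>(x\<^sup>2 - 4) \<phi>'' + x \<phi>' = d\<^sup>2 \<phi>\<close> turns \<open>(x - b)\<^sup>d\<close> into \<open>d (x - b)\<^sup>d\<^sup>-\<^sup>2\<close> times a linear polynomial, so the
  second identity contradicts separability, while the first one becomes a relation
  \<open>A (x - b)\<^sup>d\<^sup>-\<^sup>2 l + c (x - a)\<^sup>d\<^sup>-\<^sup>2 m = 0\<close> with \<open>l\<close>, \<open>m\<close> linear.  As \<open>d \<ge> 4\<close>, both \<open>l\<close> and \<open>m\<close> vanish, and
  this means \<open>2 d = 1\<close> in the field, \<open>{a, b} = {2, -2}\<close> and \<open>A = c\<close>.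

  With \<open>x = s + 1/s\<close> the identity reads \<open>s\<^sup>2\<^sup>d + 1 = c ((s - 1)\<^sup>2\<^sup>d + (s + 1)\<^sup>2\<^sup>d)\<close>.  Its derivative is
  \<open>s\<^sup>N = c ((s - 1)\<^sup>N + (s + 1)\<^sup>N)\<close> for \<open>N = 2 d - 1\<close>; writing \<open>N = p\<^sup>m r\<close> with \<open>r\<close> prime to \<open>p\<close> and
  replacing \<open>s\<close> to the power \<open>p\<^sup>m\<close> by \<open>y\<close> gives the same relation with \<open>r\<close> instead of \<open>N\<close>, and a second
  differentiation followed by \<open>y = 1\<close> forces \<open>r = 1\<close>.  Conversely, for \<open>2 d = p\<^sup>m + 1\<close> the identity
  holds by the freshman's dream.
\<close>

section \<open>Polynomials over algebraically closed fields\<close>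

lemma infinite_UNIV_alg_closed: "infinite (UNIV :: 'a::alg_closed_field set)"
proof
  assume fin: "finite (UNIV :: 'a set)"
  define p :: "'a poly" where "p = (\<Prod>a\<in>UNIV. [:-a, 1:])"
  have deg: "degree p = card (UNIV :: 'a set)"
    unfolding p_def by (subst degree_prod_eq_sum_degree) auto
  have "card (UNIV :: 'a set) > 0" using fin by (simp add: card_gt_0_iff)
  then have "degree (p + 1) > 0" using deg by (subst degree_add_eq_left) auto
  then obtain x where "poly (p + 1) x = 0" using alg_closed_imp_poly_has_root by blast
  moreover have "poly p x = 0" unfolding p_def using fin by (auto simp: poly_prod)
  ultimately show False by simp
qed

text \<open>Turns identities of values into identities of polynomials, which can then be
  differentiated; the finite set \<open>S\<close> absorbs points where a substitution breaks
  down.\<close>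

lemma poly_eqI_cofinite:
  fixes p q :: "'a::alg_closed_field poly"
  assumes "finite S" "\<And>x. x \<notin> S \<Longrightarrow> poly p x = poly q x"
  shows "p = q"
proof (rule ccontr)
  assume "p \<noteq> q"
  then have "finite {x. poly (p - q) x = 0}" by (intro poly_roots_finite) auto
  moreover have "UNIV \<subseteq> S \<union> {x. poly (p - q) x = 0}" using assms(2) by auto
  ultimately show False using assms(1) infinite_UNIV_alg_closed
    by (meson finite_Un finite_subset)
qed

text \<open>A root of multiplicity at least two is also a root of the derivative, so the multiset of
  roots from the factorization has no repetitions.\<close>

lemma card_roots_separable:
  fixes p :: "'a::alg_closed_field poly"
  assumes "p \<noteq> 0" and sep: "\<And>a. poly p a = 0 \<Longrightarrow> poly (pderiv p) a \<noteq> 0"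
  shows "card {a. poly p a = 0} = degree p"
proof -
  obtain A where A: "size A = degree p" "p = smult (lead_coeff p) (\<Prod>x\<in>#A. [:-x, 1:])"
    using alg_closed_imp_factorization[OF assms(1)] by blast
  have "count A x \<le> 1" for x
  proof (rule ccontr)
    assume "\<not> count A x \<le> 1"
    then have "replicate_mset 2 x \<subseteq># A" by (simp add: count_le_replicate_mset_subset_eq[symmetric])
    then obtain B where B: "A = replicate_mset 2 x + B" by (metis subset_mset.add_diff_inverse)
    define q where "q = smult (lead_coeff p) (\<Prod>x\<in>#B. [:-x, 1:])"
    have p: "p = [:-x, 1:] * ([:-x, 1:] * q)"
      by (subst A(2)) (simp add: B q_def numeral_2_eq_2 mult.assoc del: mult_pCons_left)
    have "poly p x = 0" "poly (pderiv p) x = 0"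
      by (subst p; simp add: pderiv_mult pderiv_pCons del: mult_pCons_left)+
    then show False using sep by blast
  qed
  then have "count A x = count (mset_set (set_mset A)) x" for x
    using count_greater_zero_iff[of A x] by (cases "x \<in># A") (simp_all add: not_in_iff le_antisym Suc_leI)
  then have "A = mset_set (set_mset A)" by (rule multiset_eqI)
  then have "size A = card (set_mset A)" by (metis size_mset_set)
  moreover have "set_mset A = {a. poly p a = 0}"
    using assms(1) by (subst A(2)) (auto simp: poly_prod_mset prod_mset_zero_iff)
  ultimately show ?thesis using A(1) by simp
qed

lemma card_nth_roots_alg_closed:
  fixes c :: "'a::alg_closed_field"
  assumes "of_nat n \<noteq> (0 :: 'a)" "c \<noteq> 0"
  shows "card {y. y ^ n = c} = n"
proof -
  have n: "n > 0" using assms(1) by (cases n) auto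
  let ?p = "monom 1 n - [:c:]"
  have "degree (monom (1::'a) n - [:c:]) = degree (monom (1::'a) n)"
    unfolding diff_conv_add_uminus by (rule degree_add_eq_left) (use n in \<open>auto simp: degree_monom_eq\<close>)
  then have deg: "degree ?p = n" by (simp add: degree_monom_eq)
  have "card {a. poly ?p a = 0} = degree ?p"
  proof (rule card_roots_separable)
    show "?p \<noteq> 0" using deg n by auto
    fix a assume "poly ?p a = 0"
    then have "a ^ n = c" by (simp add: poly_monom)
    then have "a \<noteq> 0" using assms n by auto
    then show "poly (pderiv ?p) a \<noteq> 0"
      using assms(1) by (simp add: pderiv_diff pderiv_monom poly_monom)
  qed
  then show ?thesis unfolding deg by (simp add: poly_monom)
qed

text \<open>\<open>t\<close> is a root of T^2 - x T + 1. This makes every \<open>x\<close>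
  accessible to the defining property of Chebyshev polynomials.\<close>

lemma ex_add_inverse:
  fixes x :: "'a::alg_closed_field"
  obtains t where "t \<noteq> 0" "x = t + inverse t"
proof -
  obtain t where t: "poly [:1, -x, 1:] t = 0"
    using alg_closed_imp_poly_has_root[of "[:1, -x, 1:]"] by auto
  then have "t \<noteq> 0" by auto
  moreover from t this have "x = t + inverse t" by (simp add: field_simps)
  ultimately show ?thesis using that by blast
qed

section \<open>Chebyshev polynomials and their differential equation\<close>

text \<open>Unlike the definite description \<open>chebyshev\<close>, the recurrence makes sense
  over every commutative ring and visibly commutes with coefficient maps. The start value 2 is t^0 +
  t^-0.\<close>

fun cheb :: "nat \<Rightarrow> 'a::comm_ring_1 poly" where
  "cheb 0 = 2"
| "cheb (Suc 0) = [:0, 1:]"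
| "cheb (Suc (Suc n)) = [:0, 1:] * cheb (Suc n) - cheb n"

text \<open>Second kind, with the index shifted by one from the classical convention: the value at t
  + 1/t is (t^n - t^-n) / (t - 1/t).\<close>

fun chebU :: "nat \<Rightarrow> 'a::comm_ring_1 poly" where
  "chebU 0 = 0"
| "chebU (Suc 0) = 1"
| "chebU (Suc (Suc n)) = [:0, 1:] * chebU (Suc n) - chebU n"

lemma poly_cheb:
  fixes t s :: "'a::comm_ring_1"
  assumes "t * s = 1"
  shows "poly (cheb n) (t + s) = t ^ n + s ^ n"
proof (induction n rule: cheb.induct)
  case (3 n)
  have "poly (cheb (Suc (Suc n))) (t + s) =
      t ^ Suc (Suc n) + s ^ Suc (Suc n) + (t * s - 1) * (t ^ n + s ^ n)"
    using 3 by (simp add: algebra_simps)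
  then show ?case using assms by simp
qed auto

lemma poly_chebU:
  fixes t s :: "'a::comm_ring_1"
  assumes "t * s = 1"
  shows "(t - s) * poly (chebU n) (t + s) = t ^ n - s ^ n"
proof (induction n rule: chebU.induct)
  case (3 n)
  have "(t - s) * poly (chebU (Suc (Suc n))) (t + s) =
      (t + s) * ((t - s) * poly (chebU (Suc n)) (t + s)) - (t - s) * poly (chebU n) (t + s)"
    by (simp add: algebra_simps)
  also have "\<dots> = t ^ Suc (Suc n) - s ^ Suc (Suc n) + (t * s - 1) * (t ^ n - s ^ n)"
    unfolding 3 by (simp add: algebra_simps)
  finally show ?case using assms by simp
qed auto

lemma map_poly_cheb:
  fixes h :: "'a::comm_ring_1 \<Rightarrow> 'b::comm_ring_1"
  assumes "h 1 = 1" and diff: "\<And>a b. h (a - b) = h a - h b"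
  shows "map_poly h (cheb n) = cheb n"
proof -
  have 0: "h 0 = 0" using diff[of 0 0] by simp
  have neg: "h (-1) = -1" using diff[of 0 1] assms(1) 0 by simp
  have 2: "h 2 = 2" using diff[of 1 "-1"] assms(1) neg by simp
  have D: "map_poly h (p - q) = map_poly h p - map_poly h q" for p q
    by (intro poly_eqI) (simp add: coeff_map_poly 0 diff)
  have N: "(2 :: 'c::comm_ring_1 poly) = [:2:]" by (simp add: numeral_poly)
  show ?thesis
    by (induction n rule: cheb.induct) (simp_all add: N map_poly_pCons 0 2 assms(1) D)
qed

lemma degree_cheb:
  assumes "n > 0"
  shows "degree (cheb n :: 'a::comm_ring_1 poly) = n \<and> lead_coeff (cheb n :: 'a poly) = 1"
proof -
  \<comment> \<open>The top coefficient is tracked together with a degree bound, and the index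
    starts at 1, because \<open>cheb 0\<close> is 2 and not monic.\<close>
  have "degree (cheb (Suc n) :: 'a poly) \<le> Suc n \<and> poly.coeff (cheb (Suc n) :: 'a poly) (Suc n) = 1" for n
  proof (induction n rule: less_induct)
    case (less n)
    consider "n = 0" | "n = Suc 0" | k where "n = Suc (Suc k)" by (metis not0_implies_Suc)
    then show ?case
    proof cases
      case 2
      then show ?thesis by (simp add: numeral_poly degree_diff_le)
    next
      case 3
      have IH: "degree (cheb (Suc k) :: 'a poly) \<le> Suc k"
        "degree (cheb (Suc (Suc k)) :: 'a poly) \<le> Suc (Suc k)" "poly.coeff (cheb (Suc (Suc k)) :: 'a poly) (Suc (Suc k)) = 1"
        using less.IH[of k] less.IH[of "Suc k"] 3 by auto
      have "degree (pCons 0 (cheb (Suc (Suc k))) - cheb (Suc k) :: 'a poly) \<le> Suc (Suc (Suc k))"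
        using IH by (intro degree_diff_le) (auto intro: order.trans[OF degree_pCons_le])
      moreover have "poly.coeff (pCons 0 (cheb (Suc (Suc k))) - cheb (Suc k) :: 'a poly) (Suc (Suc (Suc k))) = 1"
        using IH by (simp add: coeff_eq_0 del: cheb.simps)
      moreover have "cheb (Suc n) = (pCons 0 (cheb (Suc (Suc k))) - cheb (Suc k) :: 'a poly)"
        using 3 by simp
      ultimately show ?thesis using 3 by metis
    qed auto
  qed
  from this[of "n - 1"] assms
  have n: "degree (cheb n :: 'a poly) \<le> n" "poly.coeff (cheb n :: 'a poly) n = 1" by simp_all
  then have "n \<le> degree (cheb n :: 'a poly)" by (intro le_degree) simp
  then have "degree (cheb n :: 'a poly) = n" using n(1) by simp
  then show ?thesis using n(2) by simp
qed

lemma chebyshev_eq_cheb: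
  assumes "d > 0"
  shows "chebyshev d = (cheb d :: 'a::field poly)"
proof -
  have XX: "fls_X * fls_X_inv = (1 :: 'a fls)"
    using fls_inverse_X[where ?'a = 'a] by (metis fls_X_nonzero right_inverse)
  have "map_poly fls_const (cheb d) = (cheb d :: 'a fls poly)"
    by (rule map_poly_cheb) (auto simp: fls_minus_const)
  then have "is_chebyshev d (cheb d :: 'a poly)"
    unfolding is_chebyshev_def using degree_cheb[OF assms, where ?'a = 'a] poly_cheb[OF XX] by metis
  then show ?thesis using ex1_is_chebyshev[OF assms] is_chebyshev_chebyshev[OF assms] by blast
qed

lemma pderiv_cheb: "pderiv (cheb n :: 'a::idom poly) = of_nat n * chebU n"
proof -
  \<comment> \<open>Differentiating the recurrence leaves an extra \<open>cheb (Suc n)\<close>; this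
    identity expresses it through \<open>chebU\<close>.\<close>
  have rel: "cheb (Suc n) = [:0, 1:] * chebU (Suc n) - 2 * (chebU n :: 'a poly)" for n
  proof (induction n rule: cheb.induct)
    case (3 n)
    have "cheb (Suc (Suc (Suc n))) = [:0, 1:] * cheb (Suc (Suc n)) - (cheb (Suc n) :: 'a poly)"
      by (rule cheb.simps(3))
    also have "\<dots> = [:0, 1:] * chebU (Suc (Suc (Suc n))) - 2 * chebU (Suc (Suc n))"
      unfolding 3 by (simp add: algebra_simps del: mult_pCons_left)
    finally show ?case .
  qed (simp_all add: numeral_poly)
  have X: "pderiv [:0, 1:] = (1 :: 'a poly)" by (simp add: pderiv_pCons)
  show ?thesis
  proof (induction n rule: cheb.induct)
    case (3 n)
    have "pderiv (cheb (Suc (Suc n)) :: 'a poly) =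
      cheb (Suc n) + [:0, 1:] * pderiv (cheb (Suc n)) - pderiv (cheb n)"
      by (simp only: cheb.simps pderiv_mult pderiv_diff X) (simp add: algebra_simps)
    also have "\<dots> = of_nat (Suc (Suc n)) * chebU (Suc (Suc n))"
      unfolding 3 unfolding rel by (simp add: algebra_simps)
    finally show ?case .
  qed (auto simp: X numeral_poly pderiv_pCons)
qed

text \<open>This is t d/dt applied to (t - 1/t) U(t + 1/t) = t^n - t^-n, where X^2 - 4 = (t -
  1/t)^2; the proof works with the recurrences.\<close>

lemma chebU_ode:
  "([:0, 1:]\<^sup>2 - 4) * pderiv (chebU n) + [:0, 1:] * chebU n = of_nat n * (cheb n :: 'a::idom poly)"
proof -
  define V :: "'a poly" where "V = [:0, 1:]"
  have dV: "pderiv V = 1" by (simp add: V_def pderiv_pCons)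
  have T: "cheb (Suc (Suc n)) = V * cheb (Suc n) - cheb n"
    and U: "chebU (Suc (Suc n)) = V * chebU (Suc n) - chebU n"
    and T1: "cheb (Suc 0) = V" for n by (simp_all add: V_def)
  \<comment> \<open>The subtraction formula cos(n a) = cos((n + 1) a - a) in polynomial
    form.\<close>
  have rel: "2 * cheb n = V * cheb (Suc n) - (V\<^sup>2 - 4) * chebU (Suc n)" for n
  proof (induction n rule: cheb.induct)
    case (3 n)
    have "2 * cheb (Suc (Suc n)) = V * (2 * cheb (Suc n)) - 2 * cheb n"
      unfolding T by (simp add: algebra_simps)
    also have "\<dots> = V * (V * cheb (Suc (Suc n)) - cheb (Suc n))
        - (V\<^sup>2 - 4) * (V * chebU (Suc (Suc n)) - chebU (Suc n))"
      unfolding 3 by (simp add: right_diff_distrib mult.left_commute)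
    finally show ?case unfolding T[of "Suc n"] U[of "Suc n"] .
  qed (simp_all add: V_def power2_eq_square numeral_poly)
  have "(V\<^sup>2 - 4) * pderiv (chebU n) + V * chebU n = of_nat n * cheb n"
  proof (induction n rule: cheb.induct)
    case (3 n)
    have dU: "pderiv (chebU (Suc (Suc n))) = chebU (Suc n) + V * pderiv (chebU (Suc n)) - pderiv (chebU n)"
      unfolding U by (simp add: pderiv_diff pderiv_mult dV algebra_simps)
    have "(V\<^sup>2 - 4) * pderiv (chebU (Suc (Suc n))) + V * chebU (Suc (Suc n)) =
      V * ((V\<^sup>2 - 4) * pderiv (chebU (Suc n)) + V * chebU (Suc n)) - ((V\<^sup>2 - 4) * pderiv (chebU n) + V * chebU n)
      + (V\<^sup>2 - 4) * chebU (Suc n)"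
      unfolding dU unfolding U by (simp add: algebra_simps power2_eq_square)
    also have "\<dots> = of_nat (Suc (Suc n)) * cheb (Suc (Suc n)) +
        (2 * cheb n - (V * cheb (Suc n) - (V\<^sup>2 - 4) * chebU (Suc n)))"
      unfolding 3 T by (simp add: algebra_simps)
    finally show ?case unfolding rel by simp
  qed (auto simp: V_def)
  then show ?thesis by (simp add: V_def)
qed

lemma cheb_ode:
  fixes x :: "'a::idom"
  shows "(x\<^sup>2 - 4) * poly (pderiv (pderiv (cheb n))) x + x * poly (pderiv (cheb n)) x
    = of_nat n ^ 2 * poly (cheb n) x"
proof -
  have "pderiv (pderiv (cheb n :: 'a poly)) = of_nat n * pderiv (chebU n)"
    unfolding pderiv_cheb by (simp add: of_nat_poly pderiv_smult)
  then have "(x\<^sup>2 - 4) * poly (pderiv (pderiv (cheb n))) x + x * poly (pderiv (cheb n)) x =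
     of_nat n * poly (([:0, 1:]\<^sup>2 - 4) * pderiv (chebU n) + [:0, 1:] * chebU n) x"
    unfolding pderiv_cheb by (simp add: algebra_simps poly_of_nat)
  then show ?thesis unfolding chebU_ode by (simp add: power2_eq_square)
qed

text \<open>At a double root t + 1/t both t^n + t^-n and t^n - t^-n vanish, hence so does 2
  t^n.\<close>

lemma cheb_separable:
  fixes a :: "'a::alg_closed_field"
  assumes "of_nat n \<noteq> (0 :: 'a)" "(2 :: 'a) \<noteq> 0" "poly (cheb n) a = 0"
  shows "poly (pderiv (cheb n)) a \<noteq> 0"
proof
  assume 0: "poly (pderiv (cheb n)) a = 0"
  obtain t where t: "t \<noteq> 0" "a = t + inverse t" by (rule ex_add_inverse)
  then have ts: "t * inverse t = 1" by simp
  from 0 have "poly (chebU n) a = 0" using assms(1) by (simp add: pderiv_cheb)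
  then have "t ^ n - inverse t ^ n = 0" using poly_chebU[OF ts, of n] t by simp
  moreover have "t ^ n + inverse t ^ n = 0" using poly_cheb[OF ts, of n] t assms(3) by simp
  moreover have "2 * t ^ n = (t ^ n - inverse t ^ n) + (t ^ n + inverse t ^ n)" by simp
  ultimately have "2 * t ^ n = 0" by (simp only: add_0)
  then show False using assms(2) t by simp
qed

lemma cheb_2: "poly (cheb n) 2 = (2 :: 'a::comm_ring_1)"
  using poly_cheb[of "1::'a" 1 n] by simp

lemma cheb_minus_2: "poly (cheb n) (-2) = 2 * (-1 :: 'a::comm_ring_1) ^ n"
  using poly_cheb[of "-1::'a" "-1" n] by simp

section \<open>Chebyshev polynomials as sums of two powers\<close>

text \<open>Applying the Chebyshev operator minus n^2 to (x - b)^n gives n (x - b)^(n - 2) times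
  this factor. It is linear in \<open>x\<close> because the quadratic terms cancel.\<close>

definition ode_factor :: "nat \<Rightarrow> 'a::comm_ring_1 \<Rightarrow> 'a \<Rightarrow> 'a" where
  "ode_factor n b x = (2 * of_nat n - 1) * b * x - 4 * (of_nat n - 1) - of_nat n * b\<^sup>2"

lemma pderiv_linear_power:
  "pderiv ([:-b, 1 :: 'a::idom:] ^ Suc n) = smult (of_nat (Suc n)) ([:-b, 1:] ^ n)"
  by (simp add: pderiv_power_Suc pderiv_pCons del: power_Suc)

lemma power_ode:
  fixes x b :: "'a::idom" and n :: nat
  defines "p \<equiv> [:-b, 1:] ^ Suc (Suc n)"
  shows "(x\<^sup>2 - 4) * poly (pderiv (pderiv p)) x + x * poly (pderiv p) x =
    of_nat (Suc (Suc n)) ^ 2 * poly p x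
    + of_nat (Suc (Suc n)) * ((x - b) ^ n * ode_factor (Suc (Suc n)) b x)"
  unfolding p_def pderiv_linear_power pderiv_smult
  by (simp add: ode_factor_def poly_power algebra_simps power2_eq_square)

text \<open>The operator of \<open>cheb_ode\<close> is applied to both sides, and the terms d^2
  times the powers cancel. The case \<open>c = 0\<close> covers a power plus a constant,
  \<open>k = 0\<close> a sum of two powers.\<close>

lemma cheb_sum_powers_ode:
  fixes x :: "'a::idom"
  assumes d: "d = Suc (Suc n)" "of_nat d \<noteq> (0 :: 'a)"
    and eq: "cheb d = smult A ([:-b, 1:] ^ d) + smult c ([:-a, 1:] ^ d) + [:k:]"
  shows "A * ((x - b) ^ n * ode_factor d b x) + c * ((x - a) ^ n * ode_factor d a x) = of_nat d * k"
proof -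
  let ?D = "\<lambda>p. (x\<^sup>2 - 4) * poly (pderiv (pderiv p)) x + x * poly (pderiv p) x"
  let ?p = "[:-b, 1:] ^ d" and ?q = "[:-a, 1:] ^ d"
  have "?D (cheb d) = A * ?D ?p + c * ?D ?q"
    unfolding eq by (simp add: pderiv_add pderiv_smult pderiv_pCons algebra_simps)
  moreover have "?D (cheb d) = of_nat d ^ 2 * (A * poly ?p x + c * poly ?q x + k)"
    unfolding cheb_ode by (simp add: eq algebra_simps)
  moreover have "A * ?D ?p + c * ?D ?q = of_nat d ^ 2 * (A * poly ?p x + c * poly ?q x) +
     of_nat d * (A * ((x - b) ^ n * ode_factor d b x) + c * ((x - a) ^ n * ode_factor d a x))"
    unfolding d(1) power_ode by (simp only: distrib_left mult.left_commute mult.assoc add.assoc add.left_commute)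
  ultimately have "of_nat d * (A * ((x - b) ^ n * ode_factor d b x) + c * ((x - a) ^ n * ode_factor d a x))
     = of_nat d * (of_nat d * k)"
    by (simp add: distrib_left power2_eq_square mult.assoc)
  then show ?thesis using d(2) by (metis mult_left_cancel)
qed

text \<open>At \<open>x = b\<close> the power in the relation from the differential equation
  vanishes, its exponent d - 2 being positive, so \<open>k = 0\<close>; then \<open>b\<close> is a
  multiple root, against separability.\<close>

lemma cheb_neq_power_plus_const:
  fixes b :: "'a::alg_closed_field"
  assumes "d \<ge> 3" "of_nat d \<noteq> (0 :: 'a)" "(2 :: 'a) \<noteq> 0"
  shows "cheb d \<noteq> smult A ([:-b, 1:] ^ d) + [:k:]"
proof
  assume eq: "cheb d = smult A ([:-b, 1:] ^ d) + [:k:]"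
  define n where "n = d - 2"
  have n: "d = Suc (Suc n)" "n > 0" using assms(1) by (auto simp: n_def)
  have "cheb d = smult A ([:-b, 1:] ^ d) + smult 0 ([:-b, 1:] ^ d) + [:k:]" by (simp add: eq)
  from cheb_sum_powers_ode[OF n(1) assms(2) this, of b] n(2) assms(2) have "k = 0" by (simp add: zero_power)
  then have p: "cheb d = smult A ([:-b, 1:] ^ Suc (Suc n))" unfolding eq unfolding n(1) by simp
  have "poly (cheb d) b = 0" "poly (pderiv (cheb d)) b = 0"
    unfolding p pderiv_smult pderiv_linear_power by (simp_all add: poly_power)
  then show False using cheb_separable assms(2,3) by blast
qed

lemma cheb_eq_sum_powers:
  fixes a b :: "'a::alg_closed_field"
  assumes "d \<ge> 4" and d0: "of_nat d \<noteq> (0 :: 'a)" and two: "(2 :: 'a) \<noteq> 0"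
    and eq: "cheb d = smult A ([:-b, 1:] ^ d) + smult c ([:-a, 1:] ^ d)"
  shows "2 * of_nat d = (1 :: 'a)" "{a, b} = {2, -2}" "A = c" "c * 4 ^ d = 2"
proof -
  define n where "n = d - 3"
  have n: "d = Suc (Suc (Suc n))" "n > 0" using assms(1) by (auto simp: n_def)
  note ne = cheb_neq_power_plus_const[OF _ d0 two, where k = 0, simplified]
  \<comment> \<open>If \<open>A\<close>, \<open>c\<close> or a - b vanished, a multiple of a single
    power would remain.\<close>
  have A: "A \<noteq> 0" using ne eq assms(1) by force
  have c: "c \<noteq> 0" using ne eq assms(1) by force
  have ab: "a \<noteq> b" using ne[of "A + c" b] eq assms(1) by (auto simp: smult_add_left)
  have ode: "A * ((x - b) ^ Suc n * ode_factor d b x) + c * ((x - a) ^ Suc n * ode_factor d a x) = 0" for x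
    using cheb_sum_powers_ode[OF n(1) d0, of A b c a 0] eq by simp
  \<comment> \<open>Evaluating at one centre kills one power, so each linear factor vanishes at the
    opposite centre.\<close>
  have ba: "ode_factor d b a = 0" using ode[of a] A ab by simp
  have ab': "ode_factor d a b = 0" using ode[of b] c ab by simp
  define \<beta> where "\<beta> = (2 * of_nat d - 1) * b"
  define \<gamma> where "\<gamma> = (2 * of_nat d - 1) * a"
  have fb: "ode_factor d b x = \<beta> * (x - a)" for x
  proof -
    have "ode_factor d b x - ode_factor d b a = \<beta> * (x - a)"
      unfolding ode_factor_def \<beta>_def by (simp add: algebra_simps)
    then show ?thesis using ba by simp
  qed
  have fa: "ode_factor d a x = \<gamma> * (x - b)" for x
  proof -
    have "ode_factor d a x - ode_factor d a b = \<gamma> * (x - b)"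
      unfolding ode_factor_def \<gamma>_def by (simp add: algebra_simps)
    then show ?thesis using ab' by simp
  qed
  \<comment> \<open>Dividing by (x - a) (x - b) leaves the exponent n = d - 3. It is positive
    because d is at least 4, so evaluation at \<open>a\<close> and \<open>b\<close> still isolates
    each coefficient.\<close>
  have "smult (A * \<beta>) ([:-b, 1:] ^ n) + smult (c * \<gamma>) ([:-a, 1:] ^ n) = 0"
  proof (rule poly_eqI_cofinite)
    fix x assume x: "x \<notin> {a, b}"
    have "(x - a) * (x - b) * (A * \<beta> * (x - b) ^ n + c * \<gamma> * (x - a) ^ n) = 0"
      using ode[of x] unfolding fa fb by (simp add: algebra_simps)
    then show "poly (smult (A * \<beta>) ([:-b, 1:] ^ n) + smult (c * \<gamma>) ([:-a, 1:] ^ n)) x = poly 0 x"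
      using x by (simp add: poly_power)
  qed auto
  from arg_cong[OF this, of "\<lambda>p. poly p _"]
  have id: "A * \<beta> * (x - b) ^ n + c * \<gamma> * (x - a) ^ n = 0" for x
    by (simp add: poly_power)
  have "\<beta> = 0" using id[of a] n(2) A ab by (simp add: zero_power)
  moreover have "\<gamma> = 0" using id[of b] n(2) c ab by (simp add: zero_power)
  ultimately show d2: "2 * of_nat d = (1 :: 'a)" using ab unfolding \<beta>_def \<gamma>_def by auto
  \<comment> \<open>With 2 d = 1, twice \<open>ode_factor d y z\<close> is 4 - y^2, whatever
    \<open>z\<close> is.\<close>
  have sq: "y\<^sup>2 = 4" if "ode_factor d y z = 0" for y z :: 'a
  proof -
    have "2 * ode_factor d y z = 2 * (2 * of_nat d - 1) * y * z - 4 * (2 * of_nat d) + 8 - (2 * of_nat d) * y\<^sup>2"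
      unfolding ode_factor_def by (simp add: algebra_simps)
    then show ?thesis unfolding d2 that by simp
  qed
  have pm: "y = 2 \<or> y = -2" if "y\<^sup>2 = 4" for y :: 'a
  proof -
    have "(y - 2) * (y + 2) = 0" using that by (simp add: algebra_simps power2_eq_square)
    then show ?thesis by (auto simp: eq_neg_iff_add_eq_0)
  qed
  show ab2: "{a, b} = {2, -2}" using pm[OF sq[OF ba]] pm[OF sq[OF ab']] ab by auto
  have val: "poly (cheb d) x = A * (x - b) ^ d + c * (x - a) ^ d" for x
    unfolding eq by (simp add: poly_power)
  have neg: "(-4) ^ d = (-1) ^ d * (4 :: 'a) ^ d" by (simp add: power_minus')
  \<comment> \<open>The values 2 at 2 and 2 (-1)^d at -2 determine both coefficients, since one
    power vanishes at each of these points.\<close>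
  have "A * 4 ^ d = 2 \<and> c * 4 ^ d = 2"
  proof -
    have d: "d > 0" using n(1) by simp
    have cancel: "e * 4 ^ d = 2" if "2 * (-1) ^ d = e * (-4) ^ d" for e :: 'a
    proof -
      have "(-1) ^ d * (e * 4 ^ d) = (-1) ^ d * 2"
        using that unfolding neg by (simp only: mult.left_commute mult.commute)
      then show ?thesis by simp
    qed
    consider "a = 2" "b = -2" | "a = -2" "b = 2" using ab2 ab by (auto simp: doubleton_eq_iff)
    then show ?thesis
    proof cases
      case 1
      then show ?thesis using val[of 2] val[of "-2"] d cancel[of c]
        by (simp add: cheb_2 cheb_minus_2 zero_power)
    next
      case 2
      then show ?thesis using val[of 2] val[of "-2"] d cancel[of A]
        by (simp add: cheb_2 cheb_minus_2 zero_power)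
    qed
  qed
  moreover have "(4 :: 'a) ^ d \<noteq> 0"
  proof -
    have "(2 :: 'a) * 2 \<noteq> 0" using two by (metis mult_eq_0_iff)
    then show ?thesis by simp
  qed
  ultimately show "A = c" "c * 4 ^ d = 2" by (auto, metis mult_right_cancel)
qed

section \<open>Frobenius and the shape of the degree\<close>

lemma prime_CHAR_power_diff:
  fixes x y :: "'a::comm_ring_1"
  assumes "prime CHAR('a)"
  shows "(x - y) ^ (CHAR('a) ^ m) = x ^ (CHAR('a) ^ m) - y ^ (CHAR('a) ^ m)"
  using freshmans_dream'[OF assms refl, of "x - y" y m] by (simp add: algebra_simps)

lemma prime_power_of_sum_powers:
  fixes C :: "'a::alg_closed_field"
  assumes "N > 0" "of_nat N = (0 :: 'a)"
    and id: "\<And>s :: 'a. s ^ N = C * ((s - 1) ^ N + (s + 1) ^ N)"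
  shows "\<exists>m\<ge>1. N = CHAR('a) ^ m"
proof -
  let ?p = "CHAR('a)"
  have dvd: "?p dvd N" using assms(2) by (simp add: of_nat_eq_0_iff_char_dvd)
  then have p: "prime ?p" using assms(1) by (intro prime_CHAR_semidom) (auto intro: Nat.gr0I)
  define m where "m = multiplicity ?p N"
  obtain r where r: "N = ?p ^ m * r" "\<not> ?p dvd r"
    using multiplicity_decompose'[of N ?p] assms(1) p unfolding m_def by (metis not_prime_unit not_gr_zero)
  have m: "m \<ge> 1" using dvd assms(1) p r by (cases m) auto
  have idr: "y ^ r = C * ((y - 1) ^ r + (y + 1) ^ r)" for y :: 'a
  proof -
    have "?p ^ m > 0" using p by (simp add: prime_gt_0_nat)
    then obtain s where s: "s ^ (?p ^ m) = y" using nth_root_exists by blast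
    have "(s - 1) ^ N = (y - 1) ^ r" "(s + 1) ^ N = (y + 1) ^ r" "s ^ N = y ^ r"
      unfolding r(1) power_mult prime_CHAR_power_diff[OF p] freshmans_dream'[OF p refl] s by simp_all
    then show ?thesis using id[of s] by simp
  qed
  have "r = 1"
  proof (rule ccontr)
    assume "r \<noteq> 1"
    moreover have "r > 0" using r assms(1) by (intro Nat.gr0I) auto
    ultimately obtain k where k: "r = Suc k" "k > 0" by (cases r) auto
    have r0: "of_nat (Suc k) \<noteq> (0 :: 'a)" using r(2) unfolding k by (metis of_nat_eq_0_iff_char_dvd)
    have "[:-0, 1:] ^ Suc k = smult C ([:-1, 1:] ^ Suc k + [:-(-1 :: 'a), 1:] ^ Suc k)"
    proof (rule poly_eqI_cofinite[of "{}"])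
      show "poly ([:-0, 1:] ^ Suc k) x = poly (smult C ([:-1, 1:] ^ Suc k + [:-(-1), 1:] ^ Suc k)) x" for x :: 'a
        using idr[of x] unfolding k(1) by (simp add: poly_power add.commute del: power_Suc)
    qed auto
    from arg_cong[OF this, of pderiv] have
      "smult (of_nat (Suc k)) ([:-0, 1:] ^ k) =
       smult (of_nat (Suc k)) (smult C ([:-1, 1:] ^ k + [:-(-1 :: 'a), 1:] ^ k))"
      unfolding pderiv_smult pderiv_add pderiv_linear_power by (simp add: smult_add_right mult.commute)
    then have "[:-0, 1:] ^ k = smult C ([:-1, 1:] ^ k + [:-(-1 :: 'a), 1:] ^ k)"
      using r0 by (metis smult_cancel)
    \<comment> \<open>At 1 the term (1 - 1)^k drops out because \<open>k > 0\<close>; comparing with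
      the undifferentiated relation at 1 yields 1 = 2.\<close>
    from arg_cong[OF this, of "\<lambda>p. poly p 1"] have "1 = C * 2 ^ k"
      using k(2) by (simp add: poly_power zero_power)
    moreover have "1 = C * 2 ^ Suc k" using idr[of 1] by (simp add: k)
    ultimately have "(1 :: 'a) = 2" by (metis mult.left_commute mult.right_neutral power_Suc)
    then have "1 + 0 = (1 :: 'a) + 1" by simp
    then show False unfolding add_left_cancel by simp
  qed
  then show ?thesis using m r(1) by auto
qed

text \<open>Substituting x = s + 1/s turns x - 2 and x + 2 into (s - 1)^2 / s and (s + 1)^2 / s,
  which doubles the exponents.\<close>

lemma cheb_eq_sum_powers_imp_prime_power:
  fixes c :: "'a::alg_closed_field"
  assumes "d > 0" "2 * of_nat d = (1 :: 'a)"
    and eq: "\<And>x. poly (cheb d) x = c * ((x - 2) ^ d + (x + 2) ^ d)"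
  shows "\<exists>m\<ge>1. 2 * d = CHAR('a) ^ m + 1"
proof -
  define N where "N = 2 * d - 1"
  have N: "2 * d = Suc N" "N > 0" using assms(1) by (auto simp: N_def)
  have N1: "of_nat (Suc N) = (1 :: 'a)" using assms(2) N(1) by (metis of_nat_mult of_nat_numeral)
  have "[:-0, 1:] ^ Suc N + 1 = smult c ([:-1, 1:] ^ Suc N + [:-(-1 :: 'a), 1:] ^ Suc N)"
  proof (rule poly_eqI_cofinite[of "{0}"])
    fix s :: 'a assume s: "s \<notin> {0}"
    have "s ^ d * (s ^ d + inverse s ^ d) = s ^ d * (c * ((s + inverse s - 2) ^ d + (s + inverse s + 2) ^ d))"
      using poly_cheb[of s "inverse s" d] s eq by simp
    also have "\<dots> = c * ((s * (s + inverse s - 2)) ^ d + (s * (s + inverse s + 2)) ^ d)"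
      by (simp only: power_mult_distrib) (simp only: distrib_left mult.left_commute)
    also have "s * (s + inverse s - 2) = (s - 1) ^ 2" using s by (simp add: algebra_simps power2_eq_square)
    also have "s * (s + inverse s + 2) = (s + 1) ^ 2" using s by (simp add: algebra_simps power2_eq_square)
    also have "s ^ d * (s ^ d + inverse s ^ d) = s ^ (2 * d) + 1"
      using s by (simp add: distrib_left power_mult power2_eq_square flip: power_mult_distrib)
    finally have "s ^ Suc N + 1 = c * ((s - 1) ^ Suc N + (s + 1) ^ Suc N)"
      unfolding N(1)[symmetric] power_mult .
    then show "poly ([:-0, 1:] ^ Suc N + 1) s = poly (smult c ([:-1, 1:] ^ Suc N + [:-(-1 :: 'a), 1:] ^ Suc N)) s"
      by (simp add: poly_power add.commute del: power_Suc)
  qed auto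
  \<comment> \<open>As 2 d = 1 in the field, differentiation lowers the exponent from 2 d to
    \<open>N\<close> without introducing a factor.\<close>
  from arg_cong[OF this, of pderiv] have
    P: "[:-0, 1:] ^ N = smult c ([:-1, 1:] ^ N + [:-(-1 :: 'a), 1:] ^ N)"
    unfolding pderiv_smult pderiv_add pderiv_linear_power N1 by simp
  have id: "s ^ N = c * ((s - 1) ^ N + (s + 1) ^ N)" for s :: 'a
    using arg_cong[OF P, of "\<lambda>p. poly p s"] by (simp add: poly_power add.commute)
  have "of_nat N = (0 :: 'a)" using N1 by simp
  from prime_power_of_sum_powers[OF N(2) this id] have "\<exists>m\<ge>1. N = CHAR('a) ^ m" .
  then show ?thesis using N(1) by simp
qed

text \<open>For x = s + 1/s and q = p^m, multiplication by s^d makes the right-hand side (s - 1)^(q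
  + 1) + (s + 1)^(q + 1), and Frobenius expands this to 2 (s^(q + 1) + 1).\<close>

lemma cheb_prime_power:
  fixes x :: "'a::alg_closed_field"
  assumes p: "prime CHAR('a)" and d: "2 * d = CHAR('a) ^ m + 1"
  shows "2 * poly (cheb d) x = (x - 2) ^ d + (x + 2) ^ d"
proof -
  let ?q = "CHAR('a) ^ m"
  obtain s where s: "s \<noteq> 0" "x = s + inverse s" by (rule ex_add_inverse)
  have "s ^ d * ((x - 2) ^ d + (x + 2) ^ d) = (s * (x - 2)) ^ d + (s * (x + 2)) ^ d"
    by (simp only: power_mult_distrib) (simp only: distrib_left mult.left_commute)
  also have "s * (x - 2) = (s - 1) ^ 2" using s by (simp add: algebra_simps power2_eq_square)
  also have "s * (x + 2) = (s + 1) ^ 2" using s by (simp add: algebra_simps power2_eq_square)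
  also have "((s - 1) ^ 2) ^ d + ((s + 1) ^ 2) ^ d = (s ^ ?q - 1) * (s - 1) + (s ^ ?q + 1) * (s + 1)"
    unfolding power_mult[symmetric] d power_add prime_CHAR_power_diff[OF p] freshmans_dream'[OF p refl] by simp
  also have "\<dots> = 2 * (s ^ (?q + 1) + 1)" by (simp add: algebra_simps)
  also have "\<dots> = s ^ d * (2 * poly (cheb d) x)"
    using s poly_cheb[of s "inverse s" d] unfolding d[symmetric]
    by (simp add: distrib_left mult.left_commute[of _ 2] power_mult power2_eq_square flip: power_mult_distrib)
  finally show ?thesis using s by simp
qed

section \<open>The form, its gradient and its restriction to lines\<close>

lemma additive_map_poly:
  assumes "additive f"
  shows "additive (map_poly f)"
proof -
  interpret additive f by fact
  show ?thesis by standard (rule poly_eqI, simp add: coeff_map_poly zero add)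
qed

lemma additive_poly_map_poly:
  fixes f :: "'a::comm_ring_1 \<Rightarrow> 'b::comm_ring_1"
  assumes "additive f"
  shows "additive (\<lambda>p. poly (map_poly f p) x)"
proof -
  interpret additive "map_poly f" using assms by (rule additive_map_poly)
  show ?thesis by standard (simp add: add)
qed

lemma additive_eval3:
  fixes h :: "'a::comm_ring_1 \<Rightarrow> 'b::comm_ring_1"
  assumes "additive h"
  shows "additive (\<lambda>F. eval3 h F v)"
  unfolding eval3_def case_prod_unfold by (intro additive_poly_map_poly assms)

lemma additive_pderiv: "additive (pderiv :: 'a::idom poly \<Rightarrow> 'a poly)"
  by standard (rule pderiv_add)

lemma eval3_monom:
  assumes "h 0 = 0"
  shows "eval3 h (monom [:monom c i:] j) (x, y, z) = h c * x ^ i * z ^ j"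
  using assms by (simp add: eval3_def map_poly_monom map_poly_pCons poly_monom)

lemma eval3_var_Y_power:
  assumes "h 0 = 0"
  shows "eval3 h [:monom [:c:] i:] (x, y, z) = h c * y ^ i"
  using assms by (simp add: eval3_def map_poly_monom map_poly_pCons poly_monom)

lemma chebyshev_form_eq:
  assumes "d > 0"
  shows "chebyshev_form d = [:monom [:1:] d:] -
    (\<Sum>i\<le>d. monom [:monom (poly.coeff (cheb d) i) i:] (d - i) :: 'a::field poly3)"
proof -
  have pow: "[:0, 1:] ^ n = monom (1 :: 'b::comm_ring_1) n" for n
    by (simp add: monom_altdef)
  have Y: "var_Y ^ n = [:monom [:1 :: 'a:] n:]" for n
    unfolding var_Y_def poly_const_pow pow by (simp add: one_pCons)
  have X: "var_X ^ n = [:[:monom (1 :: 'a) n:]:]" for n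
    unfolding var_X_def poly_const_pow pow ..
  have Z: "var_Z ^ n = monom (1 :: 'a poly poly) n" for n
    unfolding var_Z_def pow ..
  have "const3 c * var_X ^ i * var_Z ^ j = monom [:monom (c :: 'a) i:] j" for c i j
    unfolding X Z by (simp add: const3_def smult_monom)
  then show ?thesis unfolding chebyshev_form_def Y by (simp add: chebyshev_eq_cheb[OF assms])
qed

text \<open>Evaluation, partial derivatives and change of base field are all additive, so each is
  computed on the monomials of the form.\<close>

lemma additive_chebyshev_form:
  fixes \<Phi> :: "'a::field poly3 \<Rightarrow> 'b::ab_group_add"
  assumes "additive \<Phi>" "d > 0"
  shows "\<Phi> (chebyshev_form d) = \<Phi> [:monom [:1:] d:] -
    (\<Sum>i\<le>d. \<Phi> (monom [:monom (poly.coeff (cheb d) i) i:] (d - i)))"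
proof -
  interpret additive \<Phi> by fact
  show ?thesis unfolding chebyshev_form_eq[OF assms(2)] by (simp add: diff sum)
qed

text \<open>The recurrence has integer coefficients, so base change reproduces the same form; the
  geometry then takes place over one algebraically closed field.\<close>

lemma chebyshev_form_ac_eq:
  assumes "d > 0"
  shows "chebyshev_form_ac TYPE('k::field) d = chebyshev_form d"
proof -
  have a: "additive (base_change (to_ac :: 'k \<Rightarrow> _))"
    unfolding base_change_def by (intro additive_map_poly additive.intro) simp
  have "map_poly to_ac (cheb d) = (cheb d :: 'k alg_closure poly)"
    by (rule map_poly_cheb) auto
  then have "to_ac (poly.coeff (cheb d) i) = poly.coeff (cheb d :: 'k alg_closure poly) i" for i
    by (metis coeff_map_poly to_ac_0)
  then show ?thesis
    unfolding chebyshev_form_ac_def additive_chebyshev_form[OF a assms]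
    unfolding chebyshev_form_eq[OF assms]
    by (simp add: base_change_def map_poly_monom map_poly_pCons)
qed

section \<open>The form as a function and its contact with lines\<close>

definition cform :: "nat \<Rightarrow> 'a::field \<Rightarrow> 'a \<Rightarrow> 'a \<Rightarrow> 'a" where
  "cform d x y z = y ^ d - (\<Sum>i\<le>d. poly.coeff (cheb d) i * x ^ i * z ^ (d - i))"

lemma eval3_chebyshev_form:
  "d > 0 \<Longrightarrow> eval3 (\<lambda>c. c) (chebyshev_form d) (x, y, z) = cform d x y z"
  by (subst additive_chebyshev_form[OF additive_eval3])
     (simp_all add: additive.intro eval3_monom eval3_var_Y_power cform_def)

text \<open>The form on \<open>P + t Q\<close>, where \<open>P = (x, y, z)\<close> and \<open>Q = (u, v, w)\<close>.\<close>

definition rpoly :: "nat \<Rightarrow> 'a::field \<Rightarrow> 'a \<Rightarrow> 'a \<Rightarrow> 'a \<Rightarrow> 'a \<Rightarrow> 'a \<Rightarrow> 'a poly" where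
  "rpoly d x y z u v w = [:y, v:] ^ d -
    (\<Sum>i\<le>d. [:poly.coeff (cheb d) i:] * [:x, u:] ^ i * [:z, w:] ^ (d - i))"

lemma restrict_line_chebyshev_form:
  assumes "d > 0" "coords P = (x, y, z)" "coords Q = (u, v, w)"
  shows "restrict_line (chebyshev_form d) P Q = rpoly d x y z u v w"
proof -
  have "additive (\<lambda>c :: 'a. [:c:])" by standard simp
  then show ?thesis
    unfolding restrict_line_def assms rpoly_def prod.case
    by (subst additive_chebyshev_form[OF additive_eval3 assms(1)])
       (simp_all add: eval3_monom eval3_var_Y_power)
qed

lemma poly_rpoly: "poly (rpoly d x y z u v w) t = cform d (x + t * u) (y + t * v) (z + t * w)"
  by (simp add: rpoly_def cform_def poly_power poly_sum mult.assoc)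

lemma degree_rpoly: "degree (rpoly d x y z u v w) \<le> d"
proof -
  have lin: "degree ([:a, b:] ^ n) \<le> n" for a b :: 'a and n
    using degree_power_le[of "[:a, b:]" n] by (rule order.trans) auto
  have "degree ([:c:] * [:x, u:] ^ i * [:z, w:] ^ (d - i)) \<le> d" if "i \<le> d" for c i
  proof -
    have "degree ([:c:] * [:x, u:] ^ i) \<le> i"
      using lin[of x u i] by (simp add: order.trans[OF degree_smult_le])
    then have "degree ([:c:] * [:x, u:] ^ i * [:z, w:] ^ (d - i)) \<le> i + (d - i)"
      using lin[of z w "d - i"] by (rule order.trans[OF degree_mult_le add_mono])
    then show ?thesis using that by simp
  qed
  then show ?thesis unfolding rpoly_def
    by (intro degree_diff_le lin degree_sum_le) auto
qed

lemma order_0_eq_degree_bound_iff: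
  fixes p :: "'a::idom poly"
  assumes "degree p \<le> d"
  shows "p \<noteq> 0 \<and> order 0 p = d \<longleftrightarrow> (\<exists>c. c \<noteq> 0 \<and> p = monom c d)"
proof
  assume p: "p \<noteq> 0 \<and> order 0 p = d"
  then have "[:0, 1:] ^ d dvd p" using order_1[of 0 p] by simp
  then have "monom 1 d dvd p" by (simp add: monom_altdef)
  then obtain q where q: "p = monom 1 d * q" by (rule dvdE)
  then have "degree p = d + degree q" using p by (simp add: degree_mult_eq degree_monom_eq)
  then have "degree q = 0" using assms by simp
  then obtain c where "q = [:c:]" by (rule degree_eq_zeroE)
  then show "\<exists>c. c \<noteq> 0 \<and> p = monom c d" using p q by (auto simp: smult_monom)
qed (use monom_eq_0_iff in auto)

text \<open>Intersection multiplicity exactly \<open>d\<close> at (x, y, z) with the line towards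
  (u, v, w): the restriction has degree at most \<open>d\<close>, so order \<open>d\<close> means a
  monomial. Vectors replace points so that the second one can be normalized.\<close>

definition contact :: "nat \<Rightarrow> 'a::field \<Rightarrow> 'a \<Rightarrow> 'a \<Rightarrow> 'a \<Rightarrow> 'a \<Rightarrow> 'a \<Rightarrow> bool" where
  "contact d x y z u v w \<longleftrightarrow> (\<exists>c. c \<noteq> 0 \<and> rpoly d x y z u v w = monom c d)"

lemma contactI:
  fixes c :: "'a::alg_closed_field"
  assumes "c \<noteq> 0" "\<And>t. cform d (x + t * u) (y + t * v) (z + t * w) = c * t ^ d"
  shows "contact d x y z u v w"
  unfolding contact_def using assms(1)
  by (intro exI[of _ c] conjI poly_eqI_cofinite[of "{}"]) (auto simp: poly_rpoly assms(2) poly_monom)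

lemma contactD:
  assumes "contact d x y z u v w"
  obtains c where "c \<noteq> 0" "\<And>t. cform d (x + t * u) (y + t * v) (z + t * w) = c * t ^ d"
  using assms unfolding contact_def by (metis poly_rpoly poly_monom)

lemma cform_homogeneous: "cform d (c * x) (c * y) (c * z) = c ^ d * cform d x y z"
proof -
  have "c ^ d = c ^ i * c ^ (d - i)" if "i \<le> d" for i
    using that by (simp flip: power_add)
  then show ?thesis
    unfolding cform_def right_diff_distrib sum_distrib_left power_mult_distrib
    by (intro arg_cong2[of _ _ _ _ minus] refl sum.cong) (simp add: mult_ac)
qed

text \<open>P + t (\<kappa> P + \<mu> Q) equals (1 + \<kappa> t) (P + s Q) with s = \<mu> t / (1 +
  \<kappa> t), and homogeneity turns c s^d into c (\<mu> t)^d.\<close>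

lemma contact_change:
  fixes x y z :: "'a::alg_closed_field"
  assumes "contact d x y z u v w" "\<mu> \<noteq> 0"
  shows "contact d x y z (\<kappa> * x + \<mu> * u) (\<kappa> * y + \<mu> * v) (\<kappa> * z + \<mu> * w)"
proof -
  obtain c where c: "c \<noteq> 0" "\<And>t. cform d (x + t * u) (y + t * v) (z + t * w) = c * t ^ d"
    using contactD[OF assms(1)] by blast
  let ?r = "rpoly d x y z (\<kappa> * x + \<mu> * u) (\<kappa> * y + \<mu> * v) (\<kappa> * z + \<mu> * w)"
  have "?r = monom (c * \<mu> ^ d) d"
  proof (rule poly_eqI_cofinite)
    \<comment> \<open>The zero of 1 + \<kappa> t; for \<kappa> = 0, where
      \<open>inverse 0 = 0\<close>, the value 0 is left out instead, which does no harm.\<close>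
    show "finite {- inverse \<kappa>}" by simp
    fix t assume t: "t \<notin> {- inverse \<kappa>}"
    define k where "k = 1 + \<kappa> * t"
    have k: "k \<noteq> 0"
    proof
      assume "k = 0"
      then have "\<kappa> * t = - 1" by (simp add: k_def add_eq_0_iff)
      then have "\<kappa> \<noteq> 0" by auto
      then have "t = - inverse \<kappa>" using \<open>\<kappa> * t = - 1\<close> by (simp add: field_simps)
      then show False using t by simp
    qed
    have "a + t * (\<kappa> * a + \<mu> * b) = k * (a + (t * \<mu> / k) * b)" for a b
      using k by (simp add: k_def field_simps)
    then have "poly ?r t = k ^ d * (c * (t * \<mu> / k) ^ d)"
      unfolding poly_rpoly by (simp only: cform_homogeneous c(2))
    also have "\<dots> = poly (monom (c * \<mu> ^ d) d) t"
      using k by (simp add: poly_monom power_mult_distrib power_divide)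
    finally show "poly ?r t = poly (monom (c * \<mu> ^ d) d) t" .
  qed
  then show ?thesis unfolding contact_def using c(1) assms(2) by auto
qed

lemma cform_affine:
  assumes "z \<noteq> 0"
  shows "cform d x y z = y ^ d - z ^ d * poly (cheb d) (x / z)"
proof -
  have "(\<Sum>i\<le>d. poly.coeff (cheb d) i * x ^ i * z ^ (d - i)) =
      (\<Sum>i\<le>d. z ^ d * (poly.coeff (cheb d) i * (x / z) ^ i))"
    using assms by (intro sum.cong) (simp_all add: power_divide power_diff)
  moreover have "poly (cheb d) (x / z) = (\<Sum>i\<le>d. poly.coeff (cheb d) i * (x / z) ^ i)"
  proof (cases "d = 0")
    case True
    then show ?thesis by (simp add: numeral_poly)
  next
    case False
    then show ?thesis using degree_cheb[of d, where ?'a = 'a] by (simp add: poly_altdef)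
  qed
  ultimately show ?thesis unfolding cform_def by (simp add: sum_distrib_left)
qed

lemma cform_at_infinity:
  assumes "d > 0"
  shows "cform d x y 0 = y ^ d - (x :: 'a::field) ^ d"
proof -
  have "(\<Sum>i\<le>d. poly.coeff (cheb d) i * x ^ i * 0 ^ (d - i)) =
    (\<Sum>i\<in>{d}. poly.coeff (cheb d) i * x ^ i * 0 ^ (d - i))"
    by (rule sum.mono_neutral_right) auto
  moreover have "poly.coeff (cheb d) d = (1 :: 'a)" using degree_cheb[OF assms, where ?'a = 'a] by metis
  ultimately show ?thesis by (simp add: cform_def)
qed

section \<open>Partial derivatives of the form\<close>

definition cgrad_x :: "nat \<Rightarrow> 'a::field \<Rightarrow> 'a \<Rightarrow> 'a" where
  "cgrad_x d x z = - (\<Sum>i\<le>d. of_nat i * poly.coeff (cheb d) i * x ^ (i - 1) * z ^ (d - i))"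

definition cgrad_z :: "nat \<Rightarrow> 'a::field \<Rightarrow> 'a \<Rightarrow> 'a" where
  "cgrad_z d x z = - (\<Sum>i\<le>d. of_nat (d - i) * poly.coeff (cheb d) i * x ^ i * z ^ (d - i - 1))"

lemma gradient_chebyshev_form:
  fixes P :: "'a::field proj_plane"
  assumes "d > 0" "coords P = (x, y, z)"
  shows "gradient (chebyshev_form d) P = (cgrad_x d x z, of_nat d * y ^ (d - 1), cgrad_z d x z)"
proof -
  note ev = additive.intro eval3_monom eval3_var_Y_power
  have id: "additive (\<lambda>c :: 'a. c)" by standard simp
  have comp: "additive (\<lambda>F :: 'a poly3. eval3 (\<lambda>c. c) (f F) (x, y, z))" if "additive f" for f
    using additive.add[OF that] additive.add[OF additive_eval3[OF id]] by (intro additive.intro) simp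
  have nat_mult: "of_nat n * [:monom c i:] = [:monom (of_nat n * c) i:]" for n i and c :: 'a
    by (simp add: of_nat_poly smult_monom)
  have "eval3 (\<lambda>c. c) (map_poly (map_poly pderiv) (chebyshev_form d)) (x, y, z) = cgrad_x d x z"
    by (subst additive_chebyshev_form[OF comp assms(1)])
       (auto intro!: additive_map_poly additive_pderiv
         simp: eval3_monom eval3_def[of _ 0] map_poly_monom map_poly_pCons pderiv_monom pderiv_pCons cgrad_x_def)
  moreover have "eval3 (\<lambda>c. c) (map_poly pderiv (chebyshev_form d)) (x, y, z) = of_nat d * y ^ (d - 1)"
    by (subst additive_chebyshev_form[OF comp assms(1)])
       (auto intro!: additive_map_poly additive_pderiv
         simp: eval3_var_Y_power eval3_def[of _ 0] map_poly_monom map_poly_pCons pderiv_monom pderiv_pCons of_nat_poly)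
  moreover have "eval3 (\<lambda>c. c) (pderiv (chebyshev_form d)) (x, y, z) = cgrad_z d x z"
    by (subst additive_chebyshev_form[OF comp assms(1)])
       (auto intro!: additive_pderiv
         simp: eval3_monom eval3_def[of _ 0] pderiv_monom pderiv_pCons nat_mult cgrad_z_def simp del: mult_pCons_right of_nat_diff)
  ultimately show ?thesis by (simp add: gradient_def assms(2))
qed

text \<open>Euler's identity; on the curve it says that a point lies on its own tangent
  line.\<close>

lemma cform_euler:
  assumes "d > 0"
  shows "cgrad_x d x z * x + of_nat d * y ^ (d - 1) * y + cgrad_z d x z * z = of_nat d * cform d x y z"
proof -
  let ?c = "poly.coeff (cheb d)"
  have x: "of_nat i * ?c i * x ^ (i - 1) * z ^ (d - i) * x = of_nat i * (?c i * x ^ i * z ^ (d - i))" for i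
    by (cases i) (simp_all add: mult_ac)
  have z: "of_nat (d - i) * ?c i * x ^ i * z ^ (d - i - 1) * z = of_nat (d - i) * (?c i * x ^ i * z ^ (d - i))" for i
    by (cases "d - i") (simp_all add: mult_ac)
  have "cgrad_x d x z * x + cgrad_z d x z * z =
    - (\<Sum>i\<le>d. (of_nat i + of_nat (d - i)) * (?c i * x ^ i * z ^ (d - i)))"
    unfolding cgrad_x_def cgrad_z_def
    by (simp only: mult_minus_left sum_distrib_right x z distrib_right sum.distrib minus_add_distrib)
  also have "\<dots> = - (\<Sum>i\<le>d. of_nat d * (?c i * x ^ i * z ^ (d - i)))"
    by (intro arg_cong[of _ _ uminus] sum.cong) (simp_all flip: of_nat_add)
  finally have "of_nat d * cform d x y z = of_nat d * y ^ d + (cgrad_x d x z * x + cgrad_z d x z * z)"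
    by (simp add: cform_def right_diff_distrib sum_distrib_left)
  then show ?thesis using power_minus_mult[OF assms, of y] by (simp add: mult.assoc)
qed

lemma cgrad_x_affine:
  assumes "z \<noteq> 0" "d > 0"
  shows "cgrad_x d x z = - (z ^ (d - 1) * poly (pderiv (cheb d)) (x / z))"
proof -
  have "cheb d = (\<Sum>i\<le>d. monom (poly.coeff (cheb d) i) i :: 'a poly)"
    using degree_cheb[OF assms(2), where ?'a = 'a] poly_as_sum_of_monoms[of "cheb d :: 'a poly"] by simp
  then have "poly (pderiv (cheb d)) (x / z) =
      poly (pderiv (\<Sum>i\<le>d. monom (poly.coeff (cheb d) i) i)) (x / z)" by simp
  also have "\<dots> = (\<Sum>i\<le>d. of_nat i * poly.coeff (cheb d) i * (x / z) ^ (i - 1))"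
    by (simp add: additive.sum[OF additive_pderiv] pderiv_monom poly_sum poly_monom)
  finally have "z ^ (d - 1) * poly (pderiv (cheb d)) (x / z) =
     (\<Sum>i\<le>d. z ^ (d - 1) * (of_nat i * poly.coeff (cheb d) i * (x / z) ^ (i - 1)))"
    by (simp add: sum_distrib_left)
  also have "\<dots> = (\<Sum>i\<le>d. of_nat i * poly.coeff (cheb d) i * x ^ (i - 1) * z ^ (d - i))"
  proof (intro sum.cong refl)
    fix i assume "i \<in> {..d}"
    show "z ^ (d - 1) * (of_nat i * poly.coeff (cheb d) i * (x / z) ^ (i - 1)) =
      of_nat i * poly.coeff (cheb d) i * x ^ (i - 1) * z ^ (d - i)"
    proof (cases i)
      case (Suc j)
      then have "z ^ (d - 1) = z ^ (d - i) * z ^ j" using \<open>i \<in> {..d}\<close> by (simp flip: power_add)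
      then show ?thesis using assms(1) Suc by (simp add: power_divide)
    qed simp
  qed
  finally show ?thesis by (simp add: cgrad_x_def)
qed

section \<open>Points and their homogeneous coordinates\<close>

lemma coords_nonzero: "coords P \<noteq> (0, 0, 0)"
  using Quotient3_rep_reflp[OF Quotient3_proj_plane, of P] by (simp add: coords_def proj_rel_def)

lemma coords_proportional:
  assumes "coords P = (x, y, z)" "coords Q = (c * x, c * y, c * z)"
  shows "P = Q"
proof -
  have "c \<noteq> 0" using coords_nonzero[of Q] assms(2) by auto
  then have "proj_rel (coords P) (coords Q)"
    using assms coords_nonzero[of P] by (auto simp: proj_rel_def)
  then show ?thesis unfolding coords_def using Quotient3_rel_rep[OF Quotient3_proj_plane] by blast
qed

text \<open>\<open>coords\<close> picks an unknown representative, so prescribed coordinates are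
  attained only up to a scalar.\<close>

lemma ex_coords:
  assumes "(x, y, z) \<noteq> (0, 0, 0)"
  obtains P c where "c \<noteq> 0" "coords P = (c * x, c * y, c * z)"
proof -
  have "proj_rel (x, y, z) (x, y, z)" using assms by (auto simp: proj_rel_def intro: exI[of _ 1])
  then have "proj_rel (rep_proj_plane (abs_proj_plane (x, y, z))) (x, y, z)"
    using rep_abs_rsp_left[OF Quotient3_proj_plane] by blast
  then obtain c where c: "c \<noteq> 0" "(x, y, z) = (case coords (abs_proj_plane (x, y, z)) of (x, y, z) \<Rightarrow> (c * x, c * y, c * z))"
    unfolding proj_rel_def coords_def by blast
  obtain u v w where uvw: "coords (abs_proj_plane (x, y, z)) = (u, v, w)" by (metis prod.exhaust)
  have "(u, v, w) = (inverse c * x, inverse c * y, inverse c * z)"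
    using c uvw by simp
  then show ?thesis using that[of "inverse c" "abs_proj_plane (x, y, z)"] c(1) uvw by simp
qed

section \<open>Total inflection points\<close>

text \<open>Keeps the direction vector nonzero when Q is replaced by a combination chosen to have a
  coordinate 0.\<close>

lemma coords_combination:
  fixes x y z :: "'a::field"
  assumes "coords P = (x, y, z)" "coords Q = (u, v, w)" "P \<noteq> Q" "\<mu> \<noteq> 0"
  shows "(\<mu> * u - \<kappa> * x, \<mu> * v - \<kappa> * y, \<mu> * w - \<kappa> * z) \<noteq> (0, 0, 0)"
proof
  assume "(\<mu> * u - \<kappa> * x, \<mu> * v - \<kappa> * y, \<mu> * w - \<kappa> * z) = (0, 0, 0)"
  then have "u = (\<kappa> / \<mu>) * x" "v = (\<kappa> / \<mu>) * y" "w = (\<kappa> / \<mu>) * z"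
    using assms(4) by (simp_all add: field_simps)
  then show False using coords_proportional[OF assms(1), of Q "\<kappa> / \<mu>"] assms(2,3) by simp
qed

lemma restrict_line_contact_iff:
  assumes "d > 0" "coords P = (x, y, z)" "coords Q = (u, v, w)"
  shows "restrict_line (chebyshev_form d) P Q \<noteq> 0 \<and> order 0 (restrict_line (chebyshev_form d) P Q) = d
    \<longleftrightarrow> contact d x y z u v w"
  unfolding restrict_line_chebyshev_form[OF assms] contact_def
  by (rule order_0_eq_degree_bound_iff[OF degree_rpoly])

lemma total_inflection_pointD:
  fixes P :: "'a::alg_closed_field proj_plane"
  assumes "d > 0" "P \<in> total_inflection_points d (chebyshev_form d)" "coords P = (x, y, z)"
  obtains u v w where "cform d x y z = 0" "contact d x y z u v w"
    "\<And>\<mu> \<kappa>. \<mu> \<noteq> 0 \<Longrightarrow> (\<mu> * u - \<kappa> * x, \<mu> * v - \<kappa> * y, \<mu> * w - \<kappa> * z) \<noteq> (0, 0, 0)"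
proof -
  let ?F = "chebyshev_form d :: 'a poly3"
  define L where "L = tangent_line ?F P"
  define Q where "Q = (SOME Q. Q \<in> L \<and> Q \<noteq> P)"
  have P: "cform d x y z = 0" "gradient ?F P \<noteq> (0, 0, 0)" "int_mult ?F L P = enat d"
    using assms by (auto simp: total_inflection_points_def curve_points_def eval3_chebyshev_form L_def)
  obtain g1 g2 g3 where g: "gradient ?F P = (g1, g2, g3)" by (metis prod.exhaust)
  have PL: "P \<in> L" using P(3) assms(1) by (auto simp: int_mult_def zero_enat_def split: if_splits)
  have "\<exists>Q. Q \<in> L \<and> Q \<noteq> P"
  proof (rule ccontr)
    assume "\<nexists>Q. Q \<in> L \<and> Q \<noteq> P"
    then have only: "Q \<in> L \<Longrightarrow> Q = P" for Q by blast
    \<comment> \<open>If P were the only point of the tangent line, every nonzero solution of its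
      equation would be a multiple of P; the cases below exhibit two independent solutions. Hence
      \<open>SOME\<close> really picks a second point.\<close>
    have line: "\<exists>c. c \<noteq> 0 \<and> (x, y, z) = (c * a, c * b, c * e)"
      if nz: "(a, b, e) \<noteq> (0, 0, 0)" and on: "g1 * a + g2 * b + g3 * e = 0" for a b e
    proof -
      obtain Q c where Q: "c \<noteq> 0" "coords Q = (c * a, c * b, c * e)" by (rule ex_coords[OF nz])
      have "g1 * (c * a) + g2 * (c * b) + g3 * (c * e) = c * (g1 * a + g2 * b + g3 * e)"
        by (simp add: algebra_simps)
      then have "Q \<in> L" using on by (simp add: L_def tangent_line_def proj_line_def g dot_def Q(2))
      then show ?thesis using only Q assms(3) by auto
    qed
    consider "g1 \<noteq> 0" | "g1 = 0" "g2 \<noteq> 0" | "g1 = 0" "g2 = 0" by blast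
    then show False
    proof cases
      case 1
      then show False using line[of g2 "-g1" 0] line[of g3 0 "-g1"] by auto
    next
      case 2
      then show False using line[of 1 0 0] line[of 0 g3 "-g2"] by auto
    next
      case 3
      then show False using line[of 1 0 0] line[of 0 1 0] by auto
    qed
  qed
  then have Q: "Q \<noteq> P" unfolding Q_def by (rule someI2_ex) blast
  obtain u v w where uvw: "coords Q = (u, v, w)" by (metis prod.exhaust)
  have "restrict_line ?F P Q \<noteq> 0 \<and> order 0 (restrict_line ?F P Q) = d"
    using P(3) PL unfolding int_mult_def Q_def[symmetric] by (simp add: Let_def split: if_splits)
  then have "contact d x y z u v w"
    using restrict_line_contact_iff[OF assms(1,3) uvw] by blast
  then show ?thesis using that[OF P(1)] coords_combination[OF assms(3) uvw] Q by blast
qed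

text \<open>The vector (g2, -g1, 0) is the direction of the affine tangent line. Contact along it
  suffices, because \<open>contact_change\<close> carries it over to the point picked by
  \<open>SOME\<close>.\<close>

lemma total_inflection_pointI:
  fixes P :: "'a::alg_closed_field proj_plane"
  assumes "d > 0" and P: "coords P = (x, y, z)" and "z \<noteq> 0" and curve: "cform d x y z = 0"
    and g: "g1 = cgrad_x d x z" "g1 \<noteq> 0" "g2 = of_nat d * y ^ (d - 1)"
    and con: "contact d x y z g2 (- g1) 0"
  shows "P \<in> total_inflection_points d (chebyshev_form d)"
proof -
  let ?F = "chebyshev_form d :: 'a poly3"
  define L where "L = tangent_line ?F P"
  define Q where "Q = (SOME Q. Q \<in> L \<and> Q \<noteq> P)"
  define g3 where "g3 = cgrad_z d x z"
  have grad: "gradient ?F P = (g1, g2, g3)"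
    unfolding g g3_def by (rule gradient_chebyshev_form[OF assms(1) P])
  have L: "R \<in> L \<longleftrightarrow> g1 * u + g2 * v + g3 * w = 0" if "coords R = (u, v, w)" for R u v w
    using that by (simp add: L_def tangent_line_def proj_line_def grad dot_def)
  have euler: "g1 * x + g2 * y + g3 * z = 0"
    using cform_euler[OF assms(1), of x z y] curve by (simp add: g g3_def)
  then have PL: "P \<in> L" using L P by simp
  have "\<exists>Q. Q \<in> L \<and> Q \<noteq> P"
  proof -
    obtain R c where R: "c \<noteq> 0" "coords R = (c * g2, c * (- g1), c * 0)"
      by (rule ex_coords[of g2 "- g1" 0]) (use g(2) in auto)
    then have "R \<in> L" using L by simp
    moreover have "R \<noteq> P" using R P assms(3) by auto
    ultimately show ?thesis by blast
  qed
  then have Q: "Q \<in> L" "Q \<noteq> P" unfolding Q_def by (rule someI2_ex, blast)+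
  obtain u v w where uvw: "coords Q = (u, v, w)" by (metis prod.exhaust)
  \<comment> \<open>(w1, w2, 0) is z Q - w P. It satisfies the tangent equation, so it is
    \<open>k\<close> times (g2, -g1, 0), which expresses Q through P and that direction.\<close>
  define w1 where "w1 = z * u - w * x"
  define w2 where "w2 = z * v - w * y"
  define k where "k = - w2 / g1"
  have "g1 * w1 + g2 * w2 = z * (g1 * u + g2 * v + g3 * w) - w * (g1 * x + g2 * y + g3 * z)"
    unfolding w1_def w2_def by (simp add: algebra_simps)
  then have "g1 * w1 + g2 * w2 = 0" using euler L[OF uvw] Q(1) by simp
  then have "g1 * w1 = - (g2 * w2)" by (simp add: eq_neg_iff_add_eq_0)
  then have w: "w1 = k * g2" "w2 = k * (- g1)"
    using g(2) by (simp_all add: k_def field_simps)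
  have "(w1, w2, z * w - w * z) \<noteq> (0, 0, 0)"
    unfolding w1_def w2_def using coords_combination[OF P uvw _ assms(3)] Q(2) by blast
  then have k: "k \<noteq> 0" using w by auto
  have "contact d x y z ((w / z) * x + (k / z) * g2) ((w / z) * y + (k / z) * (- g1)) ((w / z) * z + (k / z) * 0)"
    by (rule contact_change[OF con]) (use k assms(3) in simp)
  moreover have "(w / z) * x + (k / z) * g2 = u"
    using w(1) assms(3) unfolding w1_def by (simp add: field_simps)
  moreover have "(w / z) * y + (k / z) * (- g1) = v"
    using w(2) assms(3) unfolding w2_def by (simp add: field_simps)
  ultimately have "contact d x y z u v w" using assms(3) by simp
  then have r: "restrict_line ?F P Q \<noteq> 0 \<and> order 0 (restrict_line ?F P Q) = d"
    using restrict_line_contact_iff[OF assms(1) P uvw] by blast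
  then have "int_mult ?F L P = enat d"
    using PL unfolding int_mult_def Q_def[symmetric] by (simp add: Let_def)
  then show ?thesis
    using curve g(2) grad by (simp add: total_inflection_points_def curve_points_def eval3_chebyshev_form assms(1) P L_def)
qed

section \<open>Consequences of maximal contact\<close>

lemma linear_power_eq_const_plus_monom:
  fixes y v c :: "'a::alg_closed_field"
  assumes "d \<ge> 2" "of_nat d \<noteq> (0 :: 'a)" "v \<noteq> 0" "\<And>t. (y + t * v) ^ d = e + c * t ^ d"
  shows "y = 0"
proof -
  have "[:y, v:] ^ d = [:e:] + monom c d"
    by (rule poly_eqI_cofinite[of "{}"]) (use assms(4) in \<open>simp_all add: poly_power poly_monom\<close>)
  then have eq: "pderiv ([:y, v:] ^ d) = pderiv ([:e:] + monom c d)" by simp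
  \<comment> \<open>At t = 0 the derivative of c t^d vanishes since d is at least 2.\<close>
  have "of_nat d * (y ^ (d - 1) * v) = 0"
    using arg_cong[OF eq, of "\<lambda>p. poly p 0"] assms(1)
    by (auto simp: pderiv_power pderiv_pCons pderiv_add pderiv_monom poly_monom poly_power zero_power)
  then show ?thesis using assms by simp
qed

text \<open>If \<open>w = 0\<close>, the line is the one at infinity, where the form is y^d - (x + t
  u)^d and contact forces \<open>x = 0\<close>. On any other line, dehomogenizing writes the
  Chebyshev polynomial as a power plus a constant.\<close>

lemma contact_at_infinity:
  fixes x y :: "'a::alg_closed_field"
  assumes "d \<ge> 4" and d0: "of_nat d \<noteq> (0 :: 'a)" and two: "(2 :: 'a) \<noteq> 0"
    and xy: "x \<noteq> 0"
    and con: "contact d x y 0 u 0 w" "(u, w) \<noteq> (0, 0)"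
  shows False
proof -
  obtain c where c: "c \<noteq> 0" "\<And>t. cform d (x + t * u) y (t * w) = c * t ^ d"
    using contactD[OF con(1)] by (metis add_0 mult_zero_right add_0_right)
  show False
  proof (cases "w = 0")
    case True
    have "(x + t * u) ^ d = y ^ d + (- c) * t ^ d" for t
      using c(2)[of t] assms(1) True by (simp add: cform_at_infinity algebra_simps)
    then have "x = 0"
      using assms(1) con(2) True by (intro linear_power_eq_const_plus_monom[OF _ d0, of u x "y ^ d" "- c"]) auto
    then show False using xy by simp
  next
    case False
    have "cheb d = smult ((y / x) ^ d) ([:- (u / w), 1:] ^ d) + [:- (c / w ^ d):]"
    proof (rule poly_eqI_cofinite[of "{u / w}"])
      fix \<xi> assume \<xi>: "\<xi> \<notin> {u / w}"
      \<comment> \<open>The solution 1/t of (x + t u) / (t w) = \<xi>; it vanishes only at \<xi> = u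
        / w, hence the excluded point.\<close>
      define s where "s = (w * \<xi> - u) / x"
      have s: "s \<noteq> 0" using \<xi> False xy by (auto simp: s_def field_simps)
      define t where "t = inverse s"
      have t: "t \<noteq> 0" "t * s = 1" using s by (auto simp: t_def)
      have "x * s + u = w * \<xi>" using xy by (simp add: s_def)
      then have "(x + t * u) = t * w * \<xi>" using t(2) by (metis distrib_left mult.assoc mult.commute mult_1)
      then have arg: "(x + t * u) / (t * w) = \<xi>" using t False by simp
      have "y ^ d - (t * w) ^ d * poly (cheb d) \<xi> = c * t ^ d"
        using c(2)[of t] cform_affine[of "t * w" d "x + t * u" y] t False arg by simp
      then have "s ^ d * (y ^ d - (t * w) ^ d * poly (cheb d) \<xi>) = s ^ d * (c * t ^ d)" by simp
      then have "s ^ d * y ^ d - (s ^ d * t ^ d) * (w ^ d * poly (cheb d) \<xi>) = (s ^ d * t ^ d) * c"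
        by (simp add: right_diff_distrib power_mult_distrib mult_ac)
      moreover have "s ^ d * t ^ d = 1" using t(2) by (simp add: mult.commute flip: power_mult_distrib)
      ultimately have "s ^ d * y ^ d - w ^ d * poly (cheb d) \<xi> = c" by simp
      moreover have "s ^ d = w ^ d * (\<xi> - u / w) ^ d / x ^ d"
        unfolding s_def power_divide using False by (simp add: right_diff_distrib flip: power_mult_distrib)
      ultimately have "poly (cheb d) \<xi> = (y / x) ^ d * (\<xi> - u / w) ^ d - c / w ^ d"
        using False xy by (simp add: power_divide field_simps)
      then show "poly (cheb d) \<xi> = poly (smult ((y / x) ^ d) ([:- (u / w), 1:] ^ d) + [:- (c / w ^ d):]) \<xi>"
        by (simp add: poly_power)
    qed simp
    with cheb_neq_power_plus_const[OF _ d0 two] have "\<not> d \<ge> 3" by blast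
    then show False using assms(1) by simp
  qed
qed

text \<open>A vertical line of contact would force \<open>y = 0\<close>, and a horizontal one would
  give a power plus a constant. On any other line y is a linear function of x, and the contact
  identity becomes a sum of two powers.\<close>

lemma contact_affine:
  fixes x y z :: "'a::alg_closed_field"
  assumes "d \<ge> 4" and d0: "of_nat d \<noteq> (0 :: 'a)" and two: "(2 :: 'a) \<noteq> 0"
    and z: "z \<noteq> 0" and curve: "cform d x y z = 0"
    and con: "contact d x y z u v 0" "(u, v) \<noteq> (0, 0)" and "y \<noteq> 0"
  obtains A b c where "cheb d = smult A ([:-b, 1:] ^ d) + smult c ([:-(x / z), 1:] ^ d)"
proof -
  obtain c where c: "c \<noteq> 0" "\<And>t. cform d (x + t * u) (y + t * v) z = c * t ^ d"
    using contactD[OF con(1)] by (metis mult_zero_right add_0_right)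
  have main: "(y + t * v) ^ d - z ^ d * poly (cheb d) ((x + t * u) / z) = c * t ^ d" for t
    using c(2)[of t] by (simp add: cform_affine[OF z])
  show ?thesis
  proof (cases "u = 0")
    case True
    then have "(y + t * v) ^ d = y ^ d + c * t ^ d" for t
      using main[of t] curve by (simp add: cform_affine[OF z] algebra_simps)
    then have "y = 0" using True con(2) assms(1) by (intro linear_power_eq_const_plus_monom[OF _ d0, of v y "y ^ d" c]) auto
    then show ?thesis using assms by simp
  next
    case False
    define r where "r = z / u"
    have val: "poly (cheb d) \<xi> = (y / z + r * (\<xi> - x / z) * (v / z)) ^ d - (c / u ^ d) * (\<xi> - x / z) ^ d" for \<xi>
    proof -
      define t where "t = r * (\<xi> - x / z)"
      have "(x + t * u) / z = \<xi>" using z False by (simp add: t_def r_def field_simps)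
      then have "z ^ d * poly (cheb d) \<xi> = (y + t * v) ^ d - c * t ^ d"
        using main[of t] by (simp add: algebra_simps)
      then have "poly (cheb d) \<xi> = ((y + t * v) ^ d - c * t ^ d) / z ^ d"
        using z by (simp add: field_simps)
      also have "\<dots> = ((y + t * v) / z) ^ d - c / z ^ d * t ^ d"
        by (simp add: power_divide diff_divide_distrib)
      also have "(y + t * v) / z = y / z + r * (\<xi> - x / z) * (v / z)" by (simp add: t_def add_divide_distrib)
      also have "c / z ^ d * t ^ d = (c / u ^ d) * (\<xi> - x / z) ^ d"
        unfolding t_def r_def power_mult_distrib power_divide using z by simp
      finally show ?thesis .
    qed
    show ?thesis
    proof (cases "v = 0")
      case True
      have "cheb d = smult (- (c / u ^ d)) ([:- (x / z), 1:] ^ d) + [:(y / z) ^ d:]"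
        by (rule poly_eqI_cofinite[of "{}"]) (simp_all add: val True poly_power)
      with cheb_neq_power_plus_const[OF _ d0 two] have "\<not> d \<ge> 3" by blast
      then show ?thesis using assms(1) by simp
    next
      case v: False
      \<comment> \<open>The abscissa at which the line meets y = 0; its affine equation becomes y =
        (r v / z) (\<xi> - b).\<close>
      define b where "b = x / z - y / (r * v)"
      have r: "r \<noteq> 0" using z False by (simp add: r_def)
      have "y / z + r * (\<xi> - x / z) * (v / z) = (r * v / z) * (\<xi> - b)" for \<xi>
      proof -
        have "y / z = (r * v / z) * (y / (r * v))" using r v by simp
        then show ?thesis unfolding b_def by (simp add: algebra_simps)
      qed
      then have "cheb d = smult ((r * v / z) ^ d) ([:- b, 1:] ^ d) + smult (- (c / u ^ d)) ([:-(x / z), 1:] ^ d)"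
        by (intro poly_eqI_cofinite[of "{}"]) (simp_all add: val poly_power flip: power_mult_distrib)
      then show ?thesis by (rule that)
    qed
  qed
qed

lemma total_inflection_point_cases:
  fixes P :: "'a::alg_closed_field proj_plane"
  assumes "d \<ge> 4" and d0: "of_nat d \<noteq> (0 :: 'a)" and two: "(2 :: 'a) \<noteq> 0"
    and T: "P \<in> total_inflection_points d (chebyshev_form d)" and P: "coords P = (x, y, z)"
  shows "z \<noteq> 0 \<and> cform d x y z = 0 \<and>
    (y = 0 \<or> (\<exists>m\<ge>1. 2 * d = CHAR('a) ^ m + 1) \<and> (x / z = 2 \<or> x / z = - 2))"
proof -
  have d: "d > 0" using assms(1) by simp
  obtain u v w where F: "cform d x y z = 0" and con: "contact d x y z u v w"
    and nz: "\<And>\<mu> \<kappa>. \<mu> \<noteq> 0 \<Longrightarrow> (\<mu> * u - \<kappa> * x, \<mu> * v - \<kappa> * y, \<mu> * w - \<kappa> * z) \<noteq> (0, 0, 0)"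
    using total_inflection_pointD[OF d T P] by blast
  have z: "z \<noteq> 0"
  proof
    assume z: "z = 0"
    then have "y ^ d = x ^ d" using F d by (simp add: cform_at_infinity)
    then have xy: "x \<noteq> 0" "y \<noteq> 0" using coords_nonzero[of P] P z d by (auto simp: zero_power)
    \<comment> \<open>The second point is replaced by y Q - v P, whose second coordinate is 0; for
      affine P, below, z Q - w P has third coordinate 0.\<close>
    have "contact d x y 0 (y * u - v * x) 0 (y * w)"
      using contact_change[OF con xy(2), of "- v"] z by (simp add: mult.commute)
    moreover have "(y * u - v * x, y * w) \<noteq> (0, 0)" using nz[OF xy(2), of v] z by auto
    ultimately show False using contact_at_infinity[OF assms(1) d0 two xy(1)] by blast
  qed
  have "(\<exists>m\<ge>1. 2 * d = CHAR('a) ^ m + 1) \<and> (x / z = 2 \<or> x / z = - 2)" if y: "y \<noteq> 0"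
  proof -
    have con': "contact d x y z (z * u - w * x) (z * v - w * y) 0"
      using contact_change[OF con z, of "- w"] by (simp add: mult.commute)
    have nz': "(z * u - w * x, z * v - w * y) \<noteq> (0, 0)" using nz[OF z, of w] by auto
    obtain A b c where eq: "cheb d = smult A ([:-b, 1:] ^ d) + smult c ([:-(x / z), 1:] ^ d)"
      using contact_affine[OF assms(1) d0 two z F con' nz' y] .
    note * = cheb_eq_sum_powers[OF assms(1) d0 two eq]
    consider "x / z = 2" "b = -2" | "x / z = -2" "b = 2" using *(2) by (auto simp: doubleton_eq_iff)
    then have "poly (cheb d) t = c * ((t - 2) ^ d + (t + 2) ^ d)" for t
      by cases (simp_all add: eq *(3) poly_power distrib_left add.commute)
    from cheb_eq_sum_powers_imp_prime_power[OF d *(1) this] show ?thesis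
      using *(2) by blast
  qed
  then show ?thesis using z F by blast
qed

section \<open>Converse: the points on the three lines\<close>

lemma total_inflection_point_y_0:
  fixes P :: "'a::alg_closed_field proj_plane"
  assumes d: "d \<ge> 2" and d0: "of_nat d \<noteq> (0 :: 'a)" and two: "(2 :: 'a) \<noteq> 0"
    and P: "coords P = (x, 0, z)" and z: "z \<noteq> 0" and F: "cform d x 0 z = 0"
  shows "P \<in> total_inflection_points d (chebyshev_form d)"
proof (rule total_inflection_pointI[OF _ P z F refl])
  have root: "poly (cheb d) (x / z) = 0" using F z d by (simp add: cform_affine zero_power)
  show g: "cgrad_x d x z \<noteq> 0"
    using cheb_separable[OF d0 two root] z d by (simp add: cgrad_x_affine)
  \<comment> \<open>The tangent is the vertical line through a root of the Chebyshev polynomial; on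
    it the form reduces to the power of y.\<close>
  show "contact d x 0 z 0 (- cgrad_x d x z) 0"
    by (rule contactI[of "(- cgrad_x d x z) ^ d"])
       (use g z root in \<open>simp_all add: cform_affine power_mult_distrib[symmetric] mult.commute\<close>)
qed (use d in \<open>auto simp: zero_power\<close>)

text \<open>In affine coordinates the curve is 2 y^d = (x - e)^d + (x + e)^d. The tangent meets y =
  0 at x = -e, so on it 2 y^d equals (x + e)^d and only a multiple of (x - e)^d is left.\<close>

lemma total_inflection_point_x_eq_2:
  fixes P :: "'a::alg_closed_field proj_plane"
  assumes d: "d \<ge> 2" and d0: "of_nat d \<noteq> (0 :: 'a)" and two: "(2 :: 'a) \<noteq> 0"
    and p: "prime CHAR('a)" "2 * d = CHAR('a) ^ m + 1"
    and P: "coords P = (e * z, y, z)" and z: "z \<noteq> 0" and F: "cform d (e * z) y z = 0"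
    and e: "e = 2 \<or> e = -2"
  shows "P \<in> total_inflection_points d (chebyshev_form d)"
proof -
  have e0: "e \<noteq> 0" using e two by auto
  have val: "2 * poly (cheb d) t = (t - e) ^ d + (t + e) ^ d" for t
    using cheb_prime_power[OF p, of t] e by (auto simp: add.commute)
  have "smult 2 (cheb d) = [:-e, 1:] ^ d + [:-(-e), 1:] ^ d"
    by (rule poly_eqI_cofinite[of "{}"]) (simp_all add: val poly_power add.commute)
  then have eq: "pderiv (smult 2 (cheb d)) = pderiv ([:-e, 1:] ^ d + [:-(-e), 1:] ^ d)" by simp
  obtain k where k: "d = Suc k" "k > 0" using d by (cases d) auto
  have der: "2 * poly (pderiv (cheb d)) e = of_nat d * (2 * e) ^ (d - 1)"
    using arg_cong[OF eq, of "\<lambda>p. poly p e"]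
    unfolding k(1) pderiv_smult pderiv_add pderiv_linear_power using k(2)
    by (simp add: poly_power zero_power)
  have phi: "2 * poly (cheb d) e = (2 * e) ^ d" using val[of e] d by (simp add: zero_power)
  have yd: "2 * y ^ d = (2 * e * z) ^ d"
    using F z phi by (simp add: cform_affine power_mult_distrib mult_ac)
  have y: "y \<noteq> 0" using yd e0 z two d by (auto simp: zero_power)
  define g1 where "g1 = cgrad_x d (e * z) z"
  define g2 where "g2 = of_nat d * y ^ (d - 1)"
  have g1: "g1 = - (z ^ (d - 1) * poly (pderiv (cheb d)) e)"
    using z d by (simp add: g1_def cgrad_x_affine)
  have "poly (pderiv (cheb d)) e \<noteq> 0" using der d0 two e0 by auto
  then have g1_0: "g1 \<noteq> 0" using z by (simp add: g1)
  have g2_0: "g2 \<noteq> 0" using y d0 by (simp add: g2_def)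
  have "2 * (- g1 * (2 * e * z)) = of_nat d * (2 * e * z) ^ d"
    using der unfolding g1 k(1) by (simp add: power_mult_distrib mult_ac)
  also have "\<dots> = 2 * (g2 * y)"
    unfolding yd[symmetric] g2_def using power_minus_mult[of d y] d by (simp add: mult_ac)
  \<comment> \<open>The tangent has slope y / (2 e z), so it passes through (-e z, 0, z).\<close>
  finally have slope: "- g1 * (2 * e * z) = g2 * y" using two by (metis mult_left_cancel)
  have "contact d (e * z) y z g2 (- g1) 0"
  proof (rule contactI[of "- (g2 ^ d / 2)"])
    fix t
    have "(2 * e * z) * (y + t * (- g1)) = y * (2 * e * z) + t * (- g1 * (2 * e * z))"
      by (simp add: algebra_simps)
    also have "\<dots> = y * (2 * e * z + t * g2)" unfolding slope by (simp add: algebra_simps)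
    finally have "(2 * e * z) * (y + t * (- g1)) = y * (2 * e * z + t * g2)" .
    then have "(2 * e * z) ^ d * (y + t * (- g1)) ^ d = y ^ d * (2 * e * z + t * g2) ^ d"
      by (metis power_mult_distrib)
    then have "y ^ d * (2 * (y + t * (- g1)) ^ d) = y ^ d * (2 * e * z + t * g2) ^ d"
      unfolding yd[symmetric] by (simp add: mult_ac)
    then have 1: "2 * (y + t * (- g1)) ^ d = (2 * e * z + t * g2) ^ d" using y by simp
    have "2 * (z ^ d * poly (cheb d) ((e * z + t * g2) / z)) =
        (z * ((e * z + t * g2) / z - e)) ^ d + (z * ((e * z + t * g2) / z + e)) ^ d"
      unfolding mult.left_commute[of 2] val by (simp only: power_mult_distrib) (simp only: distrib_left)
    also have "z * ((e * z + t * g2) / z - e) = t * g2" using z by (simp add: field_simps)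
    also have "z * ((e * z + t * g2) / z + e) = 2 * e * z + t * g2" using z by (simp add: field_simps)
    finally have "2 * cform d (e * z + t * g2) (y + t * (- g1)) z = - ((t * g2) ^ d)"
      using 1 by (simp add: cform_affine[OF z] right_diff_distrib)
    then show "cform d (e * z + t * g2) (y + t * (- g1)) (z + t * 0) = - (g2 ^ d / 2) * t ^ d"
      using two by (simp add: power_mult_distrib field_simps)
  qed (use g2_0 two in simp)
  then show ?thesis
    using d by (intro total_inflection_pointI[OF _ P z F g1_def g1_0 g2_def]) auto
qed

section \<open>Counting the points\<close>

lemma card_affine_points:
  fixes S :: "('a::field \<times> 'a) set"
  shows "card {P. \<forall>x y z. coords P = (x, y, z) \<longrightarrow> z \<noteq> 0 \<and> (x / z, y / z) \<in> S} = card S"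
proof -
  define f where "f = (\<lambda>P :: 'a proj_plane. case coords P of (x, y, z) \<Rightarrow> (x / z, y / z))"
  let ?A = "{P. \<forall>x y z. coords P = (x, y, z) \<longrightarrow> z \<noteq> 0 \<and> (x / z, y / z) \<in> S}"
  have "bij_betw f ?A S"
    unfolding bij_betw_def
  proof
    show "inj_on f ?A"
    proof
      fix P Q assume PQ: "P \<in> ?A" "Q \<in> ?A" "f P = f Q"
      obtain x y z where P: "coords P = (x, y, z)" by (metis prod.exhaust)
      obtain u v w where Q: "coords Q = (u, v, w)" by (metis prod.exhaust)
      have "z \<noteq> 0" "w \<noteq> 0" "x / z = u / w" "y / z = v / w" using PQ P Q by (auto simp: f_def)
      then have "(u, v, w) = ((w / z) * x, (w / z) * y, (w / z) * z)" by (simp add: field_simps)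
      then show "P = Q" using coords_proportional[OF P] Q by metis
    qed
    show "f ` ?A = S"
    proof
      show "f ` ?A \<subseteq> S" by (auto simp: f_def split: prod.split)
      show "S \<subseteq> f ` ?A"
      proof
        fix s assume s: "s \<in> S"
        obtain a b where ab: "s = (a, b)" by (rule prod.exhaust)
        obtain P c where P: "c \<noteq> 0" "coords P = (c * a, c * b, c * 1)" by (rule ex_coords[of a b 1]) simp
        then have "P \<in> ?A" "f P = s" using s ab by (auto simp: f_def)
        then show "s \<in> f ` ?A" by blast
      qed
    qed
  qed
  then show ?thesis by (rule bij_betw_same_card)
qed

text \<open>The boolean \<open>p\<close> marks the exceptional case, so both assertions of the
  theorem are treated at once.\<close>

definition affine_inflections :: "nat \<Rightarrow> bool \<Rightarrow> ('a::comm_ring_1 \<times> 'a) set" where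
  "affine_inflections d p = {(a, b). b ^ d = poly (cheb d) a \<and> (b = 0 \<or> p \<and> (a = 2 \<or> a = -2))}"

text \<open>The line y = 0 carries one point for each of the \<open>d\<close> simple roots. Over x =
  2 and x = -2 the right-hand side is nonzero and has \<open>d\<close> distinct roots of order
  \<open>d\<close>. The three sets are disjoint.\<close>

lemma card_affine_inflections:
  fixes p :: bool
  assumes d: "d > 0" and d0: "of_nat d \<noteq> (0 :: 'a::alg_closed_field)" and two: "(2 :: 'a) \<noteq> 0"
  shows "card (affine_inflections d p :: ('a \<times> 'a) set) = (if p then 3 * d else d)"
proof -
  define R where "R = {a :: 'a. poly (cheb d) a = 0} \<times> {0 :: 'a}"
  define V where "V = (\<lambda>e :: 'a. {e} \<times> {b :: 'a. b ^ d = poly (cheb d) e})"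
  have ends: "poly (cheb d) 2 \<noteq> (0 :: 'a)" "poly (cheb d) (-2) \<noteq> (0 :: 'a)"
    using two by (simp_all add: cheb_2 cheb_minus_2)
  have deg: "degree (cheb d :: 'a poly) = d" using degree_cheb[OF d] by blast
  then have "card {a :: 'a. poly (cheb d) a = 0} = d"
    using card_roots_separable[of "cheb d :: 'a poly"] cheb_separable[OF d0 two] d by fastforce
  then have R: "card R = d" by (simp add: R_def card_cartesian_product)
  have V: "card (V 2) = d" "card (V (-2)) = d"
    using card_nth_roots_alg_closed[OF d0] ends by (simp_all add: V_def card_cartesian_product)
  have fin: "finite R" "finite (V 2)" "finite (V (-2))"
    using R V d by (auto intro: card_ge_0_finite)
  have "(2 :: 'a) \<noteq> -2"
  proof
    assume "(2 :: 'a) = -2"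
    then have "(2 :: 'a) * 2 = 0" by (simp add: eq_neg_iff_add_eq_0)
    then show False using two by (metis mult_eq_0_iff)
  qed
  then have disj: "V 2 \<inter> V (-2) = {}" "R \<inter> (V 2 \<union> V (-2)) = {}"
    using ends d by (auto simp: R_def V_def)
  show ?thesis
  proof (cases p)
    case True
    then have "affine_inflections d p = R \<union> (V 2 \<union> V (-2))"
      using d by (auto simp: affine_inflections_def R_def V_def zero_power)
    then show ?thesis using True R V fin disj by (simp add: card_Un_disjoint)
  next
    case False
    then have "affine_inflections d p = R"
      using d by (auto simp: affine_inflections_def R_def zero_power)
    then show ?thesis using False R by simp
  qed
qed

theorem proposition2p1:
  fixes d :: nat
    and C T :: "'k::field alg_closure proj_plane set"
  assumes "d \<ge> 4"
    and "\<not> CHAR('k) dvd 2 * d"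
  defines "C \<equiv> curve_points (chebyshev_form_ac TYPE('k) d)"
    and "T \<equiv> total_inflection_points d (chebyshev_form_ac TYPE('k) d)"
  shows "(CHAR('k) \<ge> 3 \<and> (\<exists>m\<ge>1. 2 * d = CHAR('k) ^ m + 1) \<longrightarrow>
            card T = 3 * d \<and>
            T = C \<inter> (proj_line (0, 1, 0) \<union> proj_line (1, 0, -2) \<union> proj_line (1, 0, 2))) \<and>
         (\<not> (CHAR('k) \<ge> 3 \<and> (\<exists>m\<ge>1. 2 * d = CHAR('k) ^ m + 1)) \<longrightarrow>
            card T = d \<and> T = C \<inter> proj_line (0, 1, 0))"
proof -
  define p where "p \<longleftrightarrow> (\<exists>m\<ge>1. 2 * d = CHAR('k) ^ m + 1)"
  have d: "d > 0" "d \<ge> 2" using assms(1) by auto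
  have "of_nat (2 * d) \<noteq> (0 :: 'k alg_closure)"
    using assms(2) by (simp only: of_nat_eq_0_iff_char_dvd CHAR_alg_closure not_False_eq_True)
  then have two: "(2 :: 'k alg_closure) \<noteq> 0" and d0: "of_nat d \<noteq> (0 :: 'k alg_closure)" by auto
  have char_neq: "CHAR('k) \<noteq> 2"
    using assms(2) by auto
  have p_iff: "CHAR('k) \<ge> 3 \<and> (\<exists>m\<ge>1. 2 * d = CHAR('k) ^ m + 1) \<longleftrightarrow> p"
  proof -
    \<comment> \<open>The values 0 and 1 would give 2 d = 1 or 2 d = 2, and the value 2 would divide
      2 d.\<close>
    have "CHAR('k) \<ge> 3" if "m \<ge> 1" "2 * d = CHAR('k) ^ m + 1" for m
    proof (rule ccontr)
      assume "\<not> CHAR('k) \<ge> 3"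
      then consider "CHAR('k) = 0" | "CHAR('k) = 1" using char_neq by linarith
      then show False using that assms(1) by cases (auto simp: zero_power)
    qed
    then show ?thesis unfolding p_def by blast
  qed
  have prime: "prime CHAR('k alg_closure)" if p
    using that p_iff by (intro prime_CHAR_semidom) auto
  \<comment> \<open>The common middle term: the classification gives \<open>T = A\<close>, the
    equations of the lines describe \<open>A\<close> inside \<open>C\<close>, and \<open>A\<close>
    is counted in affine coordinates.\<close>
  define A where "A = {P :: 'k alg_closure proj_plane.
    \<forall>x y z. coords P = (x, y, z) \<longrightarrow> z \<noteq> 0 \<and> (x / z, y / z) \<in> affine_inflections d p}"
  have A_iff: "P \<in> A \<longleftrightarrow> z \<noteq> 0 \<and> cform d x y z = 0 \<and> (y = 0 \<or> p \<and> (x / z = 2 \<or> x / z = - 2))"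
    if P: "coords P = (x, y, z)" for P x y z
  proof (cases "z = 0")
    case False
    then show ?thesis
      by (auto simp: A_def P affine_inflections_def cform_affine power_divide field_simps)
  qed (simp add: A_def P)
  have "T = A"
  proof (rule Set.set_eqI)
    fix P :: "'k alg_closure proj_plane"
    obtain x y z where P: "coords P = (x, y, z)" by (metis prod.exhaust)
    have T: "T = total_inflection_points d (chebyshev_form d)"
      unfolding T_def chebyshev_form_ac_eq[OF d(1)] ..
    show "P \<in> T \<longleftrightarrow> P \<in> A"
    proof
      assume "P \<in> T"
      then show "P \<in> A"
        using total_inflection_point_cases[OF assms(1) d0 two _ P] unfolding A_iff[OF P] p_def T by simp
    next
      assume "P \<in> A"
      then have z: "z \<noteq> 0" and F: "cform d x y z = 0" and "y = 0 \<or> p \<and> (x / z = 2 \<or> x / z = - 2)"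
        unfolding A_iff[OF P] by auto
      then consider "y = 0" | "p" "x / z = 2 \<or> x / z = -2" by blast
      then show "P \<in> T"
      proof cases
        case 1
        then show ?thesis unfolding T using total_inflection_point_y_0[OF d(2) d0 two _ z] P F by simp
      next
        case 2
        then obtain m where m: "2 * d = CHAR('k alg_closure) ^ m + 1" by (auto simp: p_def)
        have "x = (x / z) * z" using z by simp
        then show ?thesis unfolding T
          using total_inflection_point_x_eq_2[OF d(2) d0 two prime[OF 2(1)] m _ z _ 2(2)] P F by simp
      qed
    qed
  qed
  moreover have "C \<inter> (proj_line (0, 1, 0) \<union> (if p then proj_line (1, 0, -2) \<union> proj_line (1, 0, 2) else {})) = A"
  proof (rule Set.set_eqI)
    fix P :: "'k alg_closure proj_plane"
    obtain x y z where P: "coords P = (x, y, z)" by (metis prod.exhaust)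
    have C: "P \<in> C \<longleftrightarrow> cform d x y z = 0"
      unfolding C_def chebyshev_form_ac_eq[OF d(1)] by (simp add: curve_points_def P eval3_chebyshev_form d(1))
    \<comment> \<open>At infinity the curve is y^d = x^d, so a point of one of the three lines there
      would have all coordinates zero.\<close>
    have z: "z \<noteq> 0" if "cform d x y z = 0" "y = 0 \<or> x = 2 * z \<or> x = - 2 * z"
    proof
      assume "z = 0"
      then show False using that d(1) coords_nonzero[of P] by (auto simp: cform_at_infinity P zero_power)
    qed
    have lines: "P \<in> proj_line (0, 1, 0) \<longleftrightarrow> y = 0" "P \<in> proj_line (1, 0, -2) \<longleftrightarrow> x = 2 * z"
      "P \<in> proj_line (1, 0, 2) \<longleftrightarrow> x = - 2 * z"
      by (simp_all add: proj_line_def dot_def P eq_neg_iff_add_eq_0)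
    have quot: "x / z = 2 \<longleftrightarrow> x = 2 * z" "x / z = -2 \<longleftrightarrow> x = - 2 * z" if "z \<noteq> 0"
      using that by (simp_all add: field_simps)
    show "P \<in> C \<inter> (proj_line (0, 1, 0) \<union> (if p then proj_line (1, 0, -2) \<union> proj_line (1, 0, 2) else {})) \<longleftrightarrow> P \<in> A"
      unfolding A_iff[OF P] using z quot by (cases p) (auto simp: C lines)
  qed
  moreover have "card A = (if p then 3 * d else d)"
    unfolding A_def card_affine_points by (rule card_affine_inflections[OF d(1) d0 two])
  ultimately show ?thesis unfolding p_iff by (cases p) (auto simp: Un_assoc)
qed

end
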